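(* Let $a,b$ be positive integers with $a\le b$. Every nonnegative integer can be written as $ax^2+by^2+4(z^2+zw+w^2)$ with $x,y,z,w\in\mathbb{Z}$ if and only if $a=1$ and $b=2$. *)

theory Defs
  imports Main
begin

end

theory Submission
  imports Defs
    "HOL-Number_Theory.Number_Theory"
    "HOL-Number_Theory.Prime_Powers"
    "HOL-Computational_Algebra.Squarefree"
begin

text \<open>
  The values at \<open>1\<close>, \<open>2\<close>, \<open>3\<close> force \<open>a = 1\<close> and \<open>b = 2\<close>. Conversely, with \<open>w = 2 * v\<close> the form becomes
  \<open>x\<^sup>2 + 2 * y\<^sup>2 + 4 * u\<^sup>2 + 12 * v\<^sup>2\<close>, and after scaling away factors \<open>4\<close> and taking \<open>v \<in> {0, 1}\<close> its
  universality reduces to the theorem that every \<open>n \<equiv> 1, 2 (mod 4)\<close> is a sum of three squares.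

  For squarefree such \<open>n\<close> choose a prime \<open>q \<equiv> 1 (mod 4)\<close> such that \<open>n\<close> is a square modulo \<open>q\<close> and \<open>-q\<close> is a
  square modulo \<open>n\<close>. Then \<open>z\<^sup>2 + q * w\<^sup>2 = n * t\<^sup>2\<close> is solvable by a pigeonhole argument, and since
  \<open>q\<close> is a sum of two squares, \<open>n\<close> is a sum of three rational, hence (Davenport--Cassels) of three
  integral squares.

  The conditions on \<open>q\<close> only prescribe the values of finitely many independent real characters, so
  Dirichlet's method needs real characters only. Its finite form due to Mertens and Shapiro bounds
  \<open>\<Sum> \<chi>(d) \<Lambda>(d) / d\<close>, and \<open>L(1, \<chi>) \<noteq> 0\<close> follows from Monsky's argument with
  \<open>\<Sum> \<chi>(n) t\<^sup>n / (1 - t\<^sup>n)\<close> as \<open>t\<close> tends to \<open>1\<close>.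
\<close>

section \<open>Real characters\<close>

text \<open>Summation by parts: the sum is \<open>A n * b n\<close> plus the partial sums
  \<open>A (Suc k)\<close> weighted by the nonnegative decrements \<open>b k - b (Suc k)\<close>.
  Each partial sum is at most \<open>C\<close> in absolute value, and the total weight telescopes to
  \<open>b m\<close>.\<close>

lemma abel_inequality:
  fixes a b :: "nat \<Rightarrow> real"
  assumes bounded: "\<And>n. \<bar>\<Sum>k\<in>{m..<n}. a k\<bar> \<le> C"
    and decreasing: "\<And>k. m \<le> k \<Longrightarrow> b (Suc k) \<le> b k"
    and nonneg: "\<And>k. m \<le> k \<Longrightarrow> 0 \<le> b k"
  shows "\<bar>\<Sum>k\<in>{m..<n}. a k * b k\<bar> \<le> C * b m"
proof -
  define A where "A n = (\<Sum>k\<in>{m..<n}. a k)" for n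
  have C: "0 \<le> C" using bounded[of m] by simp
  show ?thesis
  proof (cases "m \<le> n")
    case True
    have "(\<Sum>k\<in>{m..<n}. a k * b k) = A n * b n + (\<Sum>k\<in>{m..<n}. A (Suc k) * (b k - b (Suc k)))"
      using True by (induction n rule: dec_induct) (auto simp: A_def algebra_simps)
    moreover have telescope: "(\<Sum>k\<in>{m..<n}. b k - b (Suc k)) = b m - b n"
      using True by (induction n rule: dec_induct) auto
    moreover have "\<bar>A n * b n\<bar> \<le> C * b n"
      using bounded[of n] nonneg[OF True] by (simp add: A_def abs_mult mult_right_mono)
    moreover have "\<bar>\<Sum>k\<in>{m..<n}. A (Suc k) * (b k - b (Suc k))\<bar>
        \<le> (\<Sum>k\<in>{m..<n}. C * (b k - b (Suc k)))"
    proof (rule order_trans[OF sum_abs sum_mono])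
      fix k assume "k \<in> {m..<n}"
      then have "0 \<le> b k - b (Suc k)" using decreasing by simp
      then show "\<bar>A (Suc k) * (b k - b (Suc k))\<bar> \<le> C * (b k - b (Suc k))"
        unfolding abs_mult using bounded[of "Suc k"] by (intro mult_mono) (auto simp: A_def)
    qed
    moreover have "C * b n + C * (b m - b n) = C * b m" by (simp add: algebra_simps)
    ultimately show ?thesis
      unfolding sum_distrib_left[symmetric] telescope by linarith
  next
    case False
    then show ?thesis using C nonneg[of m] by simp
  qed
qed

lemma periodic_add_mult:
  fixes f :: "nat \<Rightarrow> 'a"
  assumes "\<And>n. f (n + N) = f n"
  shows "f (n + k * N) = f n"
proof (induction k)
  case (Suc k)
  have "f (n + Suc k * N) = f (n + k * N + N)" by (simp add: algebra_simps)
  then show ?case using Suc assms by simp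
qed simp

text \<open>The values at arguments not coprime to \<open>N\<close> are left open, so that the
  Legendre symbols for different primes dividing \<open>N\<close> are all characters of one common
  modulus.\<close>

locale real_character =
  fixes N :: nat and \<chi> :: "nat \<Rightarrow> real"
  assumes modulus_pos: "0 < N"
    and one: "\<chi> 1 = 1"
    and mult: "\<chi> (m * n) = \<chi> m * \<chi> n"
    and periodic: "\<chi> (n + N) = \<chi> n"
    and range: "\<chi> n \<in> {-1, 0, 1}"
begin

lemma mod_modulus: "\<chi> (n mod N) = \<chi> n"
  using periodic_add_mult[of \<chi> N "n mod N" "n div N", OF periodic] by simp

lemma abs_le_1: "\<bar>\<chi> n\<bar> \<le> 1"
  using range[of n] by auto

lemma power: "\<chi> (n ^ k) = \<chi> n ^ k"
  using one by (induction k) (simp_all add: mult)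

lemma abs_sum_le_card: "\<bar>\<Sum>k\<in>S. \<chi> k\<bar> \<le> card S"
proof -
  have "\<bar>\<Sum>k\<in>S. \<chi> k\<bar> \<le> (\<Sum>k\<in>S. 1)" by (rule order_trans[OF sum_abs sum_mono]) (rule abs_le_1)
  then show ?thesis by simp
qed

end

section \<open>Cancellation for nonprincipal characters and the series L(1, \<chi>)\<close>

locale nonprincipal_real_character = real_character +
  assumes nonprincipal: "\<exists>a. coprime a N \<and> \<chi> a = -1"
begin

text \<open>Multiplication by a unit \<open>a\<close> with \<open>\<chi> a = -1\<close> permutes the
  residues, so the sum over a period equals its own negative.\<close>

lemma sum_period: "(\<Sum>k<N. \<chi> k) = 0"
proof -
  obtain a where a: "coprime a N" "\<chi> a = -1" using nonprincipal by blast
  have inj: "inj_on (\<lambda>k. a * k mod N) {..<N}"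
  proof (rule inj_onI)
    fix x y assume xy: "x \<in> {..<N}" "y \<in> {..<N}" "a * x mod N = a * y mod N"
    then have "[a * x = a * y] (mod N)" by (simp add: cong_def)
    then have "[x = y] (mod N)" using a by (simp add: cong_mult_lcancel_nat)
    then show "x = y" using xy by (simp add: cong_def)
  qed
  have "(\<lambda>k. a * k mod N) ` {..<N} = {..<N}"
    using modulus_pos by (intro endo_inj_surj inj) auto
  then have "(\<Sum>k<N. \<chi> k) = (\<Sum>k<N. \<chi> (a * k mod N))"
    using inj by (metis (no_types, lifting) sum.reindex_cong)
  also have "\<dots> = - (\<Sum>k<N. \<chi> k)"
    by (simp add: mod_modulus mult a sum_negf)
  finally show ?thesis by simp
qed

text \<open>Full periods cancel, which leaves fewer than \<open>N\<close> terms of absolute value at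
  most 1.\<close>

lemma abs_sum_lessThan: "\<bar>\<Sum>k<n. \<chi> k\<bar> \<le> N"
proof -
  have "(\<Sum>k<q * N + r. \<chi> k) = (\<Sum>k<r. \<chi> k)" for q r
  proof (induction q)
    case (Suc q)
    have "{..<Suc q * N + r} = {..<N} \<union> {N..<(q * N + r) + N}" by auto
    then have "(\<Sum>k<Suc q * N + r. \<chi> k) = (\<Sum>k<N. \<chi> k) + (\<Sum>k=0+N..<(q * N + r) + N. \<chi> k)"
      by (simp add: sum.union_disjoint ivl_disj_int)
    also have "\<dots> = (\<Sum>k<q * N + r. \<chi> k)"
      unfolding sum.shift_bounds_nat_ivl by (simp add: sum_period periodic atLeast0LessThan)
    finally show ?case using Suc by simp
  qed simp
  from this[of "n div N" "n mod N"] have "(\<Sum>k<n. \<chi> k) = (\<Sum>k<n mod N. \<chi> k)" by simp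
  also have "\<bar>\<dots>\<bar> \<le> n mod N" using abs_sum_le_card[of "{..<n mod N}"] by simp
  also have "\<dots> \<le> N" using modulus_pos by (simp add: less_imp_le)
  finally show ?thesis by simp
qed

lemma abs_sum_ivl: "\<bar>\<Sum>k\<in>{m..<n}. \<chi> k\<bar> \<le> 2 * real N"
proof (cases "m \<le> n")
  case True
  then have "(\<Sum>k\<in>{m..<n}. \<chi> k) = (\<Sum>k<n. \<chi> k) - (\<Sum>k<m. \<chi> k)"
    using sum_diff_nat_ivl[of 0 m n \<chi>] by (simp add: lessThan_atLeast0)
  then show ?thesis using abs_sum_lessThan[of n] abs_sum_lessThan[of m] by linarith
qed auto

lemma abs_sum_weighted:
  fixes b :: "nat \<Rightarrow> real"
  assumes "\<And>k. m \<le> k \<Longrightarrow> b (Suc k) \<le> b k" "\<And>k. m \<le> k \<Longrightarrow> 0 \<le> b k"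
  shows "\<bar>\<Sum>k\<in>{m..<n}. \<chi> k * b k\<bar> \<le> 2 * real N * b m"
  using abel_inequality[of \<chi> m "2 * real N" b n] abs_sum_ivl assms by simp

definition L :: real where "L = lim (\<lambda>n. \<Sum>k\<in>{1..<n}. \<chi> k / k)"

text \<open>Abel summation with the weights \<open>1 / k\<close> bounds every block starting at
  \<open>m\<close> by \<open>2 * N / m\<close>. This yields convergence, which makes the
  \<open>lim\<close> in \<open>L\<close> meaningful, and, with the upper end sent to infinity, the
  tail bound.\<close>

lemma L_tail:
  assumes "0 < m"
  shows "\<bar>(\<Sum>k\<in>{1..<m}. \<chi> k / k) - L\<bar> \<le> 2 * real N / m"
proof -
  define P where "P n = (\<Sum>k\<in>{1..<n}. \<chi> k / real k)" for n
  have diff: "\<bar>P n - P m\<bar> \<le> 2 * real N / m" if "0 < m" "m \<le> n" for m n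
  proof -
    have "P n - P m = (\<Sum>k\<in>{m..<n}. \<chi> k * (1 / k))"
      using that sum_diff_nat_ivl[of 1 m n "\<lambda>k. \<chi> k / real k"] by (simp add: P_def)
    also have "\<bar>\<dots>\<bar> \<le> 2 * real N * (1 / real m)"
    proof (rule abs_sum_weighted)
      show "1 / real (Suc k) \<le> 1 / real k" "0 \<le> 1 / real k" if "m \<le> k" for k
        using that \<open>0 < m\<close> by (simp_all add: frac_le)
    qed
    finally show ?thesis by simp
  qed
  have "Cauchy P"
  proof (rule metric_CauchyI)
    fix e :: real assume "0 < e"
    obtain M :: nat where M: "4 * real N / e < M" using reals_Archimedean2 by blast
    then have "0 < M" using \<open>0 < e\<close> modulus_pos
      by (metis divide_pos_pos gr_zeroI less_trans mult_pos_pos of_nat_0 of_nat_0_less_iff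
          order_less_irrefl zero_less_numeral)
    have "dist (P i) (P j) < e" if "M \<le> i" "M \<le> j" for i j
    proof -
      have "\<bar>P i - P M\<bar> \<le> 2 * real N / M" "\<bar>P j - P M\<bar> \<le> 2 * real N / M" using diff \<open>0 < M\<close> that by auto
      moreover have "4 * real N / M < e" using M \<open>0 < e\<close> \<open>0 < M\<close> by (simp add: field_simps)
      ultimately show ?thesis unfolding dist_real_def by linarith
    qed
    then show "\<exists>M. \<forall>m\<ge>M. \<forall>n\<ge>M. dist (P m) (P n) < e" by blast
  qed
  then have lim: "P \<longlonglongrightarrow> L"
    by (simp add: L_def P_def[abs_def] Cauchy_convergent convergent_LIMSEQ_iff[symmetric])
  have "(\<lambda>n. \<bar>P m - P n\<bar>) \<longlonglongrightarrow> \<bar>P m - L\<bar>" by (intro tendsto_intros lim)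
  moreover have "\<forall>n\<ge>m. \<bar>P m - P n\<bar> \<le> 2 * real N / m" using diff[OF assms] by (simp add: abs_minus_commute)
  ultimately have "\<bar>P m - L\<bar> \<le> 2 * real N / m" by (rule LIMSEQ_le_const2[OF _ exI])
  then show ?thesis by (simp add: P_def)
qed

end

section \<open>Divisor sums of a real character\<close>

lemma sum_divisors_swap:
  fixes f :: "nat \<Rightarrow> nat \<Rightarrow> 'a :: comm_monoid_add"
  shows "(\<Sum>n\<in>{1..X}. \<Sum>d | d dvd n. f d (n div d)) = (\<Sum>d\<in>{1..X}. \<Sum>k\<in>{1..X div d}. f d k)"
proof -
  have "(\<Sum>n\<in>{1..X}. \<Sum>d | d dvd n. f d (n div d))
      = (\<Sum>(n, d)\<in>(SIGMA n:{1..X}. {d. d dvd n}). f d (n div d))"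
    by (rule sum.Sigma) auto
  also have "\<dots> = (\<Sum>(d, k)\<in>(SIGMA d:{1..X}. {1..X div d}). f d k)"
  \<comment> \<open>A pair \<open>(n, d)\<close> with \<open>d dvd n\<close> corresponds to the pair
    \<open>(d, k)\<close> with \<open>n = d * k\<close>.\<close>
  proof (rule sum.reindex_bij_witness[of _ "\<lambda>(d, k). (d * k, d)" "\<lambda>(n, d). (d, n div d)"], goal_cases)
    case (2 a)
    then show ?case
      by (auto elim!: dvdE simp: less_eq_div_iff_mult_less_eq Suc_le_eq mult.commute)
        (metis One_nat_def Suc_leI dual_order.trans mult.commute mult_le_mono1 nat_mult_1)
  next
    case (4 b)
    then show ?case
      by (auto simp: Suc_le_eq) (metis less_eq_div_iff_mult_less_eq mult.commute neq0_conv)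
  qed auto
  also have "\<dots> = (\<Sum>d\<in>{1..X}. \<Sum>k\<in>{1..X div d}. f d k)"
    by (rule sum.Sigma[symmetric]) auto
  finally show ?thesis .
qed

text \<open>Every divisor of \<open>p ^ k * m\<close> is \<open>p ^ i * d\<close> in exactly one
  way, since \<open>i\<close> can be read off as its multiplicity of \<open>p\<close>. Hence the
  divisor sum is multiplicative and is determined by geometric sums at prime powers.\<close>

lemma (in real_character) sum_divisors_prime_power_mult:
  fixes p m :: nat
  assumes p: "prime p" "\<not> p dvd m"
  shows "(\<Sum>d | d dvd p ^ k * m. \<chi> d) = (\<Sum>i\<le>k. \<chi> p ^ i) * (\<Sum>d | d dvd m. \<chi> d)"
proof -
  have "inj_on (\<lambda>(i, d). p ^ i * d) ({..k} \<times> {d. d dvd m})"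
  proof (rule inj_onI, clarify)
    fix i d j e assume *: "d dvd m" "e dvd m" "p ^ i * d = p ^ j * e"
    have "multiplicity p (p ^ i * d) = i" "multiplicity p (p ^ j * e) = j"
      using p *(1,2) dvd_trans
      by (auto intro!: multiplicity_eqI simp: prime_gt_0_nat)
    then have "i = j" using *(3) by simp
    then show "i = j \<and> d = e" using * p by auto
  qed
  moreover have "(\<lambda>(i, d). p ^ i * d) ` ({..k} \<times> {d. d dvd m}) = {d. d dvd p ^ k * m}"
  proof (intro equalityI subsetI)
    fix d assume "d \<in> {d. d dvd p ^ k * m}"
    then obtain x y where xy: "d = x * y" "x dvd p ^ k" "y dvd m"
      using dvd_productE[of d "p ^ k" m] by auto
    then obtain i where "i \<le> k" "x = p ^ i" using p by (auto simp: divides_primepow_nat)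
    then show "d \<in> (\<lambda>(i, d). p ^ i * d) ` ({..k} \<times> {d. d dvd m})" using xy by force
  qed (auto intro: mult_dvd_mono le_imp_power_dvd)
  ultimately have "(\<Sum>d | d dvd p ^ k * m. \<chi> d) = (\<Sum>(i, d)\<in>{..k} \<times> {d. d dvd m}. \<chi> (p ^ i * d))"
    by (metis (no_types, lifting) case_prod_unfold sum.reindex_cong)
  also have "\<dots> = (\<Sum>i\<le>k. \<chi> p ^ i) * (\<Sum>d | d dvd m. \<chi> d)"
    by (simp add: sum.cartesian_product[symmetric] sum_product mult power)
  finally show ?thesis .
qed

text \<open>Only the value -1 needs care: the alternating sum is 1 or 0 according to the parity of
  \<open>k\<close>. This is why squares, whose prime exponents are all even, have divisor sums of at
  least 1.\<close>

lemma (in real_character) sum_powers: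
  "0 \<le> (\<Sum>i\<le>k. \<chi> n ^ i)" "even k \<Longrightarrow> 1 \<le> (\<Sum>i\<le>k. \<chi> n ^ i)"
proof -
  have neg: "(\<Sum>i\<le>k. (-1::real) ^ i) = (if even k then 1 else 0)" by (induction k) auto
  have zero: "(\<Sum>i\<le>k. (0::real) ^ i) = 1" by (induction k) auto
  show "0 \<le> (\<Sum>i\<le>k. \<chi> n ^ i)" "even k \<Longrightarrow> 1 \<le> (\<Sum>i\<le>k. \<chi> n ^ i)"
    using range[of n] neg zero by auto
qed

lemma prime_power_decomposition:
  fixes n :: nat
  assumes "1 < n"
  obtains p k m where "prime p" "n = p ^ k * m" "\<not> p dvd m" "m < n" "0 < m"
proof -
  obtain p where p: "prime p" "p dvd n" using assms by (metis less_irrefl prime_factor_nat)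
  obtain m where m: "n = p ^ multiplicity p n * m" "\<not> p dvd m"
    using multiplicity_decompose'[of n p] p assms
    by (metis not_prime_unit not_one_less_zero)
  have "1 < p ^ multiplicity p n"
    using p assms by (intro one_less_power) (auto simp: prime_gt_Suc_0_nat prime_multiplicity_gt_zero_iff)
  moreover have "0 < m" using m assms by (metis gr0I mult_0_right not_less_zero)
  ultimately show ?thesis using that[OF p(1) m] m(1) by (metis mult_less_cancel2 mult_1)
qed

lemma (in real_character) sum_divisors_nonneg: "0 < n \<Longrightarrow> 0 \<le> (\<Sum>d | d dvd n. \<chi> d)"
proof (induction n rule: less_induct)
  case (less n)
  show ?case
  proof (cases "n = 1")
    case True
    then show ?thesis using one by simp
  next
    case False
    then obtain p k m where "prime p" "n = p ^ k * m" "\<not> p dvd m" "m < n" "0 < m"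
      using prime_power_decomposition[of n] less.prems by auto
    then show ?thesis using less.IH sum_powers(1)
      by (simp add: sum_divisors_prime_power_mult)
  qed
qed

lemma (in real_character) sum_divisors_square: "0 < n \<Longrightarrow> 1 \<le> (\<Sum>d | d dvd n\<^sup>2. \<chi> d)"
proof (induction n rule: less_induct)
  case (less n)
  show ?case
  proof (cases "n = 1")
    case True
    then show ?thesis using one by simp
  next
    case False
    then obtain p k m where *: "prime p" "n = p ^ k * m" "\<not> p dvd m" "m < n" "0 < m"
      using prime_power_decomposition[of n] less.prems by auto
    have "n\<^sup>2 = p ^ (2 * k) * m\<^sup>2" by (simp add: * power_mult_distrib power_mult[symmetric] mult.commute)
    moreover have "\<not> p dvd m\<^sup>2" using * prime_dvd_power by blast
    moreover have "1 * 1 \<le> (\<Sum>i\<le>2 * k. \<chi> p ^ i) * (\<Sum>d | d dvd m\<^sup>2. \<chi> d)"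
      using less.IH * sum_powers(2)[of "2 * k" p] by (intro mult_mono) auto
    ultimately show ?thesis using *(1) by (simp add: sum_divisors_prime_power_mult)
  qed
qed

section \<open>Nonvanishing at 1\<close>

text \<open>The gap between the approximation \<open>1 / (n * (1 - t))\<close> and the Lambert term
  \<open>t ^ n / (1 - t ^ n)\<close>. Summed against a character, the approximation yields L(1,
  \<chi>) / (1 - t), so if L(1, \<chi>) vanishes only the gap remains.\<close>

definition monsky :: "real \<Rightarrow> nat \<Rightarrow> real" where
  "monsky t n = 1 / (n * (1 - t)) - t ^ n / (1 - t ^ n)"

context
  fixes t :: real
  assumes t: "0 < t" "t < 1"
begin

lemma monsky_eq:
  assumes "0 < n"
  shows "(1 - t) * monsky t n = 1 / n - t ^ n / (\<Sum>i<n. t ^ i)"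
proof -
  have "1 - t ^ n = (1 - t) * (\<Sum>i<n. t ^ i)" by (rule one_diff_power_eq)
  moreover have "(1 - t) * (1 / (n * (1 - t))) = 1 / n" using t by simp
  ultimately show ?thesis using t by (simp add: monsky_def right_diff_distrib)
qed

text \<open>Pair \<open>t ^ i\<close> with \<open>t ^ (n - 1 - i)\<close>: their product is
  \<open>t ^ (n - 1)\<close>, so by the inequality of arithmetic and geometric means each pair
  contributes at least \<open>2 * sqrt t ^ (n - 1)\<close>.\<close>

lemma geometric_sum_ge: "(\<Sum>i<n. t ^ i) \<ge> n * sqrt t ^ (n - 1)"
proof -
  have "2 * sqrt t ^ (n - 1) \<le> t ^ i + t ^ (n - Suc i)" if "i < n" for i
  proof -
    have "n - 1 = i + (n - Suc i)" using that by simp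
    then have "2 * sqrt t ^ (n - 1) = 2 * sqrt t ^ i * sqrt t ^ (n - Suc i)"
      by (simp add: power_add)
    also have "\<dots> \<le> (sqrt t ^ i)\<^sup>2 + (sqrt t ^ (n - Suc i))\<^sup>2" by (rule sum_squares_bound)
    also have "\<dots> = t ^ i + t ^ (n - Suc i)"
      using t by (simp flip: power_mult add: mult.commute[of _ 2] power_mult)
    finally show ?thesis .
  qed
  then have "(\<Sum>i<n. 2 * sqrt t ^ (n - 1)) \<le> (\<Sum>i<n. t ^ i + t ^ (n - Suc i))"
    by (intro sum_mono) auto
  then show ?thesis by (simp add: sum.distrib sum.nat_diff_reindex[of "\<lambda>i. t ^ i"])
qed

lemma monsky_nonneg:
  assumes "0 < n"
  shows "0 \<le> monsky t n"
proof -
  have "(\<Sum>i<n. t ^ n) \<le> (\<Sum>i<n. t ^ i)"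
    using t by (intro sum_mono power_decreasing) auto
  then have le: "n * t ^ n \<le> (\<Sum>i<n. t ^ i)" by simp
  moreover have "0 < n * t ^ n" using assms t by simp
  ultimately have "t ^ n / (\<Sum>i<n. t ^ i) \<le> 1 / n"
    using assms by (simp add: field_simps)
  then have "0 \<le> (1 - t) * monsky t n" by (simp add: monsky_eq[OF assms])
  then show ?thesis using t by (simp add: zero_le_mult_iff)
qed

text \<open>After multiplication by \<open>1 - t\<close>, the Lambert terms drop by
  \<open>t ^ n / (G n * G (Suc n))\<close> with geometric sums \<open>G\<close>. The lower bounds
  for both sums make this at most \<open>1 / (n * Suc n)\<close>, which is exactly the drop of
  \<open>1 / n\<close>.\<close>

lemma monsky_decreasing:
  assumes "0 < n"
  shows "monsky t (Suc n) \<le> monsky t n"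
proof -
  define G where "G n = (\<Sum>i<n. t ^ i)" for n
  have step: "G (Suc n) - t * G n = 1"
    unfolding G_def sum.lessThan_Suc_shift by (simp add: sum_distrib_left)
  have "0 < G k" if "0 < k" for k
    unfolding G_def using that t by (intro sum_pos) (auto simp: lessThan_empty_iff)
  then have pos: "0 < G n" "0 < G (Suc n)" using assms by auto
  have "sqrt t ^ n * sqrt t ^ n = t ^ n" using t by (simp flip: power_mult_distrib)
  then have "n * Suc n * t ^ n = n * Suc n * (sqrt t ^ n * sqrt t ^ n)" by simp
  also have "\<dots> \<le> n * Suc n * (sqrt t ^ (n - 1) * sqrt t ^ n)"
    using t by (intro mult_left_mono mult_right_mono power_decreasing) auto
  also have "\<dots> = (n * sqrt t ^ (n - 1)) * (Suc n * sqrt t ^ (Suc n - 1))"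
    by (simp only: of_nat_mult diff_Suc_1 mult_ac)
  also have "\<dots> \<le> G n * G (Suc n)"
    unfolding G_def using t by (intro mult_mono geometric_sum_ge) (auto intro!: sum_nonneg)
  finally have le: "n * Suc n * t ^ n \<le> G n * G (Suc n)" .
  have "t ^ n / G n - t ^ Suc n / G (Suc n) = t ^ n * (G (Suc n) - t * G n) / (G n * G (Suc n))"
    using pos by (simp add: field_simps)
  also have "\<dots> = t ^ n / (G n * G (Suc n))" by (simp add: step)
  also have "\<dots> \<le> 1 / (n * Suc n)"
  proof -
    have "0 < n * Suc n" using assms by simp
    then have "0 < real (n * Suc n)" by (simp only: of_nat_0_less_iff)
    then show ?thesis using le pos
      by (simp add: pos_divide_le_eq pos_le_divide_eq mult.commute del: of_nat_mult of_nat_Suc)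
  qed
  also have "\<dots> = 1 / n - 1 / Suc n" using assms by (simp add: field_simps)
  finally have "(1 - t) * monsky t (Suc n) \<le> (1 - t) * monsky t n"
    unfolding monsky_eq[OF assms] monsky_eq[OF zero_less_Suc] by (simp add: G_def)
  then show ?thesis using t by simp
qed

end


context nonprincipal_real_character
begin

text \<open>Swapping the sums produces a truncated geometric series for each \<open>d\<close>,
  within \<open>t ^ X / (1 - t)\<close> of the Lambert term. The Lambert terms split into the
  partial sum of L(1, \<chi>), which is only a tail because \<open>L = 0\<close>, and the monotone
  weights \<open>monsky t d\<close>, handled by Abel summation. For fixed \<open>t\<close> both
  error terms vanish as \<open>X\<close> grows.\<close>

lemma monsky_sum_bound:
  fixes t :: real
  assumes t: "0 < t" "t < 1" and L: "L = 0"
  shows "(\<Sum>n\<in>{1..X}. (\<Sum>d | d dvd n. \<chi> d) * t ^ n)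
    \<le> 2 * real N + 2 * real N / real (Suc X) / (1 - t) + X * t ^ X / (1 - t)"
proof -
  have tail: "\<bar>\<chi> d * (\<Sum>k\<in>{1..X div d}. t ^ (d * k)) - \<chi> d * (t ^ d / (1 - t ^ d))\<bar> \<le> t ^ X / (1 - t)"
    if "d \<in> {1..X}" for d
  proof -
    define K where "K = X div d"
    have d: "0 < d" using that by simp
    have "t ^ d < 1" "t ^ d \<le> t" using t d by (auto simp: power_less_one_iff intro: power_le_imp_le_exp power_decreasing[of 1 d t, simplified])
    have "(\<Sum>k\<in>{1..K}. t ^ (d * k)) = (\<Sum>k\<in>{1..K}. (t ^ d) ^ k)" by (simp add: power_mult)
    also have "\<dots> = (t ^ d - (t ^ d) ^ Suc K) / (1 - t ^ d)"
      using \<open>t ^ d < 1\<close> by (simp add: sum_gp)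
    finally have "t ^ d / (1 - t ^ d) - (\<Sum>k\<in>{1..K}. t ^ (d * k)) = (t ^ d) ^ Suc K / (1 - t ^ d)"
      by (simp add: diff_divide_distrib)
    moreover have "(t ^ d) ^ Suc K / (1 - t ^ d) \<le> t ^ X / (1 - t)"
    proof (rule frac_le)
      have "X \<le> d * Suc K" using d by (metis K_def dividend_less_times_div less_imp_le mult_Suc_right add.commute)
      then show "(t ^ d) ^ Suc K \<le> t ^ X"
        unfolding power_mult[symmetric] using t by (intro power_decreasing) auto
    qed (use t \<open>t ^ d \<le> t\<close> in auto)
    moreover have "0 \<le> (t ^ d) ^ Suc K / (1 - t ^ d)" using t \<open>t ^ d < 1\<close> by simp
    ultimately have le: "\<bar>(\<Sum>k\<in>{1..K}. t ^ (d * k)) - t ^ d / (1 - t ^ d)\<bar> \<le> t ^ X / (1 - t)" by linarith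
    have "\<bar>\<chi> d * y\<bar> \<le> \<bar>y\<bar>" for y
      using abs_le_1[of d] by (simp add: abs_mult mult_left_le_one_le)
    from order_trans[OF this le] show ?thesis unfolding K_def right_diff_distrib .
  qed
  have "(\<Sum>n\<in>{1..X}. (\<Sum>d | d dvd n. \<chi> d) * t ^ n) = (\<Sum>n\<in>{1..X}. \<Sum>d | d dvd n. \<chi> d * t ^ (d * (n div d)))"
    by (simp add: sum_distrib_right)
  also have "\<dots> = (\<Sum>d\<in>{1..X}. \<chi> d * (\<Sum>k\<in>{1..X div d}. t ^ (d * k)))"
    by (subst sum_divisors_swap) (simp add: sum_distrib_left)
  also have "\<dots> = (\<Sum>d\<in>{1..X}. \<chi> d * (t ^ d / (1 - t ^ d)))
      + (\<Sum>d\<in>{1..X}. \<chi> d * (\<Sum>k\<in>{1..X div d}. t ^ (d * k)) - \<chi> d * (t ^ d / (1 - t ^ d)))"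
    by (simp add: sum_subtractf)
  finally have split: "(\<Sum>n\<in>{1..X}. (\<Sum>d | d dvd n. \<chi> d) * t ^ n) = (\<Sum>d\<in>{1..X}. \<chi> d * (t ^ d / (1 - t ^ d)))
      + (\<Sum>d\<in>{1..X}. \<chi> d * (\<Sum>k\<in>{1..X div d}. t ^ (d * k)) - \<chi> d * (t ^ d / (1 - t ^ d)))" .
  have "(\<Sum>d\<in>{1..X}. \<chi> d * (\<Sum>k\<in>{1..X div d}. t ^ (d * k)) - \<chi> d * (t ^ d / (1 - t ^ d)))
      \<le> X * (t ^ X / (1 - t))"
    using sum_mono[of "{1..X}", OF order_trans[OF abs_ge_self tail]] by simp
  moreover have "(\<Sum>d\<in>{1..X}. \<chi> d * (t ^ d / (1 - t ^ d)))
      = (\<Sum>d\<in>{1..<Suc X}. \<chi> d / d) / (1 - t) - (\<Sum>d\<in>{1..<Suc X}. \<chi> d * monsky t d)"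
    unfolding atLeastLessThanSuc_atLeastAtMost
    by (simp add: monsky_def right_diff_distrib sum_subtractf sum_divide_distrib)
  moreover have "(\<Sum>d\<in>{1..<Suc X}. \<chi> d / d) / (1 - t) \<le> 2 * real N / real (Suc X) / (1 - t)"
    using t L_tail[of "Suc X"] unfolding L by (intro divide_right_mono) auto
  moreover have "- (\<Sum>d\<in>{1..<Suc X}. \<chi> d * monsky t d) \<le> 2 * real N"
  proof -
    have "monsky t 1 = 1" using t by (simp add: monsky_def field_simps)
    moreover have "\<bar>\<Sum>d\<in>{1..<Suc X}. \<chi> d * monsky t d\<bar> \<le> 2 * real N * monsky t 1"
      using t by (intro abs_sum_weighted monsky_nonneg monsky_decreasing) auto
    ultimately show ?thesis by simp
  qed
  ultimately show ?thesis unfolding split by simp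
qed

text \<open>Divisor sums are nonnegative, and at least 1 at squares. If \<open>L = 0\<close>, the
  previous bound therefore keeps the sums of \<open>t ^ m^2\<close> below \<open>2 * N\<close>
  uniformly in \<open>t\<close>; but \<open>2 * N + 1\<close> such terms tend to
  \<open>2 * N + 1\<close> as \<open>t\<close> tends to 1.\<close>

lemma L_nonzero: "L \<noteq> 0"
proof
  assume L: "L = 0"
  have bound: "(\<Sum>m\<in>{1..K}. t ^ m\<^sup>2) \<le> 2 * real N" if t: "0 < t" "t < 1" for t :: real and K
  proof (rule LIMSEQ_le_const)
    have "(\<lambda>X. inverse (real (Suc X))) \<longlonglongrightarrow> 0" by (rule LIMSEQ_inverse_real_of_nat)
    moreover have "(\<lambda>X. X * t ^ X) \<longlonglongrightarrow> 0" using t powser_times_n_limit_0[of t] by simp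
    ultimately have "(\<lambda>X. 2 * real N + 2 * real N * inverse (real (Suc X)) / (1 - t) + X * t ^ X / (1 - t))
        \<longlonglongrightarrow> 2 * real N + 2 * real N * 0 / (1 - t) + 0 / (1 - t)"
      using t by (intro tendsto_intros) auto
    then show "(\<lambda>X. 2 * real N + 2 * real N / real (Suc X) / (1 - t) + X * t ^ X / (1 - t)) \<longlonglongrightarrow> 2 * real N"
      by (simp add: divide_inverse)
    have "(\<Sum>m\<in>{1..K}. t ^ m\<^sup>2) \<le> 2 * real N + 2 * real N / real (Suc X) / (1 - t) + X * t ^ X / (1 - t)"
      if "K\<^sup>2 \<le> X" for X
    proof -
      have "(\<Sum>m\<in>{1..K}. t ^ m\<^sup>2) \<le> (\<Sum>m\<in>{1..K}. (\<Sum>d | d dvd m\<^sup>2. \<chi> d) * t ^ m\<^sup>2)"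
        using sum_divisors_square t by (intro sum_mono) (auto simp: mult_le_cancel_right1)
      also have "\<dots> = (\<Sum>n\<in>(\<lambda>m. m\<^sup>2) ` {1..K}. (\<Sum>d | d dvd n. \<chi> d) * t ^ n)"
        by (subst sum.reindex) (auto intro: inj_onI)
      also have "\<dots> \<le> (\<Sum>n\<in>{1..X}. (\<Sum>d | d dvd n. \<chi> d) * t ^ n)"
      proof (rule sum_mono2)
        show "(\<lambda>m. m\<^sup>2) ` {1..K} \<subseteq> {1..X}"
          using that by (auto intro: order_trans[OF power_mono])
      qed (use t sum_divisors_nonneg in auto)
      finally show ?thesis using monsky_sum_bound[OF t L, of X] by linarith
    qed
    then show "\<exists>n. \<forall>X\<ge>n. (\<Sum>m\<in>{1..K}. t ^ m\<^sup>2)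
        \<le> 2 * real N + 2 * real N / real (Suc X) / (1 - t) + X * t ^ X / (1 - t)" by blast
  qed
  define K where "K = Suc (2 * N)"
  have "((\<lambda>t. \<Sum>m\<in>{1..K}. t ^ m\<^sup>2) \<longlongrightarrow> (\<Sum>m\<in>{1..K}. 1 ^ m\<^sup>2)) (at_left (1::real))"
    by (intro tendsto_intros)
  moreover have "\<forall>\<^sub>F t in at_left (1::real). t \<in> {0<..<1}" by (rule eventually_at_leftI[of 0]) auto
  then have "\<forall>\<^sub>F t in at_left (1::real). (\<Sum>m\<in>{1..K}. t ^ m\<^sup>2) \<le> 2 * real N"
    by eventually_elim (use bound in auto)
  ultimately have "(\<Sum>m\<in>{1..K}. 1 ^ m\<^sup>2) \<le> 2 * real N"
    by (rule tendsto_upperbound) simp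
  then show False by (simp add: K_def)
qed

end

section \<open>Primes with prescribed character values\<close>

lemma ln_fact_eq_sum_ln: "ln (fact n :: real) = (\<Sum>m\<in>{1..n}. ln (real m))"
  by (induction n) (simp_all add: ln_mult)

lemma ln_Suc_diff_le:
  assumes "0 < n"
  shows "real n * (ln (Suc n) - ln n) \<le> 1"
proof -
  have "real (Suc n) = n * (1 + 1 / n)" using assms by (simp add: field_simps)
  then have "ln (real (Suc n)) = ln (real n) + ln (1 + 1 / n)" using assms by (simp only: ln_mult_pos) (simp add: ln_mult_pos add_pos_pos)
  moreover have "ln (1 + 1 / real n) \<le> 1 / n" by (rule ln_add_one_self_le_self) simp
  ultimately show ?thesis using assms by (simp add: field_simps)
qed

text \<open>The identity expressing \<open>ln m\<close> as the sum of \<open>mangoldt d\<close> over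
  \<open>d dvd m\<close>, summed over \<open>m\<close>; this is Legendre's formula for the factorial
  in logarithmic form.\<close>

lemma ln_fact_eq_sum_mangoldt:
  "ln (fact n :: real) = (\<Sum>d\<in>{1..n}. mangoldt d * real (n div d))"
proof -
  have "ln (fact n :: real) = (\<Sum>m\<in>{1..n}. ln (real m))" by (rule ln_fact_eq_sum_ln)
  also have "\<dots> = (\<Sum>m\<in>{1..n}. \<Sum>d | d dvd m. mangoldt d)"
    by (intro sum.cong refl) (simp add: mangoldt_sum)
  also have "\<dots> = (\<Sum>d\<in>{1..n}. \<Sum>k\<in>{1..n div d}. mangoldt d)"
    by (rule sum_divisors_swap)
  finally show ?thesis by (simp add: mult.commute)
qed

text \<open>Chebyshev's argument with the central binomial coefficient: its logarithm is the sum of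
  \<open>mangoldt d\<close> with weights \<open>2 * m div d - 2 * (m div d)\<close>, which are
  nonnegative, and at least 1 for \<open>m < d \<le> 2 * m\<close>. The coefficient itself is at
  most \<open>4 ^ m\<close>, and \<open>ln 2 < 1\<close>.\<close>

lemma sum_mangoldt_double:
  "(\<Sum>d\<in>{1..2 * m}. mangoldt d :: real) \<le> (\<Sum>d\<in>{1..m}. mangoldt d) + 2 * m"
proof -
  have "(\<Sum>d\<in>{m<..2 * m}. mangoldt d :: real)
      \<le> (\<Sum>d\<in>{1..2 * m}. mangoldt d * (real (2 * m div d) - 2 * real (m div d)))"
  proof -
    have nonneg: "0 \<le> real (2 * m div d) - 2 * real (m div d)" for d
    proof -
      have "2 * (m div d) \<le> 2 * m div d"
        by (cases "d = 0") (simp_all add: less_eq_div_iff_mult_less_eq)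
      then show ?thesis by linarith
    qed
    have "mangoldt d \<le> mangoldt d * (real (2 * m div d) - 2 * real (m div d))" if "d \<in> {m<..2 * m}" for d
    proof -
      have "1 \<le> 2 * m div d" using that by (simp add: less_eq_div_iff_mult_less_eq del: One_nat_def)
      moreover have "m div d = 0" using that by simp
      ultimately show ?thesis using mangoldt_nonneg[of d] by (simp add: mult_le_cancel_left1)
    qed
    then have "(\<Sum>d\<in>{m<..2 * m}. mangoldt d :: real)
      \<le> (\<Sum>d\<in>{m<..2 * m}. mangoldt d * (real (2 * m div d) - 2 * real (m div d)))"
      by (intro sum_mono)
    also have "\<dots> \<le> (\<Sum>d\<in>{1..2 * m}. mangoldt d * (real (2 * m div d) - 2 * real (m div d)))"
      using nonneg mangoldt_nonneg by (intro sum_mono2) auto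
    finally show ?thesis .
  qed
  also have "\<dots> = ln (fact (2 * m)) - 2 * ln (fact m)"
  proof -
    have "(\<Sum>d\<in>{1..m}. mangoldt d * real (m div d)) = (\<Sum>d\<in>{1..2 * m}. mangoldt d * real (m div d))"
      by (rule sum.mono_neutral_left) auto
    then show ?thesis
      by (simp add: ln_fact_eq_sum_mangoldt right_diff_distrib sum_subtractf sum_distrib_left mult_ac)
  qed
  also have "\<dots> = ln (real (2 * m choose m))"
    by (simp add: binomial_fact ln_div ln_mult)
  also have "\<dots> \<le> ln (2 ^ (2 * m))"
  proof (rule ln_mono)
    have "real (2 * m choose m) \<le> real (2 ^ (2 * m))"
      by (simp only: of_nat_le_iff binomial_le_pow2)
    then show "real (2 * m choose m) \<le> 2 ^ (2 * m)" by simp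
  qed auto
  also have "\<dots> = 2 * m * ln 2" by (simp add: ln_realpow)
  also have "\<dots> \<le> 2 * m" using ln_2_less_1 by (simp add: mult_left_le)
  finally have "(\<Sum>d\<in>{m<..2 * m}. mangoldt d :: real) \<le> 2 * m" by simp
  moreover have "{1..2 * m} = {1..m} \<union> {m<..2 * m}" by auto
  then have "(\<Sum>d\<in>{1..2 * m}. mangoldt d :: real) = (\<Sum>d\<in>{1..m}. mangoldt d) + (\<Sum>d\<in>{m<..2 * m}. mangoldt d)"
    by (simp add: sum.union_disjoint ivl_disj_int)
  ultimately show ?thesis by simp
qed

text \<open>Repeated doubling gives the constant 2 at powers of two; rounding \<open>n\<close> up to
  a power of two costs another factor 2.\<close>

lemma sum_mangoldt_le: "(\<Sum>d\<in>{1..n}. mangoldt d :: real) \<le> 4 * n"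
proof (cases "n = 0")
  case False
  have pow: "(\<Sum>d\<in>{1..2 ^ k}. mangoldt d :: real) \<le> 2 * 2 ^ k" for k
  proof (induction k)
    case (Suc k)
    then show ?case using sum_mangoldt_double[of "2 ^ k"] by simp
  qed simp
  obtain k where k: "2 ^ k \<le> n" "n < 2 ^ Suc k" using ex_power_ivl1[of 2 n] False by auto
  have "(\<Sum>d\<in>{1..n}. mangoldt d :: real) \<le> (\<Sum>d\<in>{1..2 ^ Suc k}. mangoldt d)"
    using k by (intro sum_mono2) (auto simp: mangoldt_nonneg)
  also have "\<dots> \<le> 2 * 2 ^ Suc k" by (rule pow)
  also have "\<dots> \<le> 4 * n"
  proof -
    have "real (2 ^ k) \<le> real n" using k(1) by (simp only: of_nat_le_iff)
    then show ?thesis by simp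
  qed
  finally show ?thesis .
qed simp

lemma ln_fact_ge: "n * ln n - n \<le> ln (fact n :: real)"
proof (induction n)
  case (Suc n)
  show ?case
  proof (cases "n = 0")
    case False
    then have "real n * ln (Suc n) - n * ln n \<le> 1"
      using ln_Suc_diff_le[of n] by (simp add: right_diff_distrib)
    moreover have "ln (fact (Suc n) :: real) = ln (Suc n) + ln (fact n)"
      unfolding fact_Suc by (rule ln_mult_pos) auto
    ultimately show ?thesis using Suc by (simp add: distrib_right)
  qed simp
qed simp

lemma ln_over_decreasing:
  assumes "3 \<le> (k::nat)"
  shows "ln (Suc k) / Suc k \<le> ln k / k"
proof -
  have "k * (ln (Suc k) - ln k) \<le> 1" using assms by (intro ln_Suc_diff_le) simp
  also have "\<dots> \<le> ln k"
  proof -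
    have "exp 1 \<le> real k" using exp_le assms by linarith
    then show ?thesis using assms by (simp add: ln_ge_iff)
  qed
  finally have "k * ln (Suc k) \<le> Suc k * ln k" by (simp add: algebra_simps)
  then show ?thesis using assms by (simp add: field_simps)
qed

section \<open>The Mertens-Shapiro bound for nonprincipal characters\<close>

context nonprincipal_real_character
begin

lemma sum_ln_bounded: "\<exists>C. \<forall>x. \<bar>\<Sum>n\<in>{1..x}. \<chi> n * (ln n / n)\<bar> \<le> C"
proof (intro exI allI)
  fix x
  \<comment> \<open>The weight \<open>ln n / n\<close> is decreasing only from 3 on, so the terms 1
    and 2 are split off before Abel summation.\<close>
  have small: "\<bar>\<Sum>n\<in>A. \<chi> n * (ln n / n)\<bar> \<le> ln 2 / 2" if "A \<subseteq> {1..2}" for A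
  proof -
    have "\<bar>\<chi> n * (ln n / n)\<bar> \<le> ln n / n" if "n \<in> A" for n
    proof -
      have "0 \<le> ln n" using that \<open>A \<subseteq> {1..2}\<close> by auto
      then show ?thesis
        using mult_left_le_one_le[of "ln n / n" "\<bar>\<chi> n\<bar>"] abs_le_1[of n] by (simp add: abs_mult)
    qed
    then have "\<bar>\<Sum>n\<in>A. \<chi> n * (ln n / n)\<bar> \<le> (\<Sum>n\<in>A. ln n / n)"
      by (intro order_trans[OF sum_abs sum_mono])
    also have "\<dots> \<le> (\<Sum>n\<in>{1..2}. ln (real n) / n)" using that by (intro sum_mono2) auto
    finally show ?thesis by (simp add: numeral_2_eq_2)
  qed
  have "\<bar>\<Sum>n\<in>{3..<Suc x}. \<chi> n * (ln n / n)\<bar> \<le> 2 * real N * (ln (real 3) / real 3)"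
    by (intro abs_sum_weighted ln_over_decreasing) auto
  moreover have "(\<Sum>n\<in>{1..x}. \<chi> n * (ln n / n))
      = (\<Sum>n\<in>{1..x} \<inter> {1..2}. \<chi> n * (ln n / n)) + (\<Sum>n\<in>{3..<Suc x}. \<chi> n * (ln n / n))"
  proof -
    have "({1..x} \<inter> {1..2}) \<union> {3..<Suc x} = {1..x}" by auto
    moreover have "({1..x} \<inter> {1..2}) \<inter> {3..<Suc x} = {}" by auto
    ultimately show ?thesis
      using sum.union_disjoint[of "{1..x} \<inter> {1..2}" "{3..<Suc x}" "\<lambda>n. \<chi> n * (ln n / n)"] by (simp del: atLeastLessThanSuc)
  qed
  ultimately show "\<bar>\<Sum>n\<in>{1..x}. \<chi> n * (ln n / n)\<bar> \<le> ln 2 / 2 + 2 * real N * (ln (real 3) / real 3)"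
    using small[OF Int_lower2[of "{1..x}" "{1..2}"]] by linarith
qed

text \<open>Writing \<open>ln\<close> as a divisor sum of \<open>mangoldt\<close> turns the bounded
  sum of \<open>\<chi> n * ln n / n\<close> into a sum over \<open>d\<close> whose inner factor is a
  partial sum of L(1, \<chi>). Replacing that factor by \<open>L\<close> costs at most
  \<open>8 * N\<close> in total by the Chebyshev bound, so \<open>L * S\<close> is bounded, and
  \<open>L\<close> may be divided out because it is nonzero.\<close>

lemma sum_mangoldt_bounded: "\<exists>C. \<forall>x. \<bar>\<Sum>d\<in>{1..x}. \<chi> d * mangoldt d / d\<bar> \<le> C"
proof -
  obtain A where A: "\<bar>\<Sum>n\<in>{1..x}. \<chi> n * (ln n / n)\<bar> \<le> A" for x using sum_ln_bounded by blast
  show ?thesis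
  proof (intro exI allI)
    fix x
    define S where "S = (\<Sum>d\<in>{1..x}. \<chi> d * mangoldt d / real d)"
    have "(\<Sum>n\<in>{1..x}. \<chi> n * (ln n / n))
        = (\<Sum>n\<in>{1..x}. \<Sum>d | d dvd n. \<chi> d * mangoldt d / d * (\<chi> (n div d) / (n div d)))"
    proof (intro sum.cong refl)
      fix n assume "n \<in> {1..x}"
      then have "\<chi> n * (ln n / n) = (\<Sum>d | d dvd n. \<chi> n * (mangoldt d / n))"
        by (simp add: mangoldt_sum sum_distrib_left[symmetric] sum_divide_distrib[symmetric])
      also have "\<dots> = (\<Sum>d | d dvd n. \<chi> d * mangoldt d / d * (\<chi> (n div d) / (n div d)))"
        using \<open>n \<in> {1..x}\<close> by (intro sum.cong refl) (auto elim!: dvdE simp: mult)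
      finally show "\<chi> n * (ln n / n)
          = (\<Sum>d | d dvd n. \<chi> d * mangoldt d / d * (\<chi> (n div d) / (n div d)))" .
    qed
    also have "\<dots> = (\<Sum>d\<in>{1..x}. \<chi> d * mangoldt d / d * (\<Sum>k\<in>{1..x div d}. \<chi> k / k))"
      by (subst sum_divisors_swap) (simp add: sum_distrib_left)
    also have "\<dots> - L * S = (\<Sum>d\<in>{1..x}. \<chi> d * mangoldt d / d * ((\<Sum>k\<in>{1..x div d}. \<chi> k / k) - L))"
      by (simp add: S_def right_diff_distrib sum_subtractf sum_distrib_left mult_ac)
    also have "\<bar>\<dots>\<bar> \<le> (\<Sum>d\<in>{1..x}. mangoldt d / d * (2 * real N * d / x))"
    proof (rule order_trans[OF sum_abs sum_mono])
      fix d assume d: "d \<in> {1..x}"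
      have "\<bar>(\<Sum>k\<in>{1..x div d}. \<chi> k / k) - L\<bar> \<le> 2 * real N / Suc (x div d)"
        using L_tail[of "Suc (x div d)"] by (simp add: atLeastLessThanSuc_atLeastAtMost)
      also have "\<dots> \<le> 2 * real N * d / x"
      proof -
        have "x \<le> d * Suc (x div d)" using d dividend_less_times_div[of d x] by simp
        then have "real x \<le> real d * real (Suc (x div d))"
          by (simp only: of_nat_le_iff of_nat_mult[symmetric])
        then have "2 * real N * x \<le> 2 * real N * (real d * real (Suc (x div d)))" by (intro mult_left_mono) auto
        then show ?thesis using d by (simp add: divide_le_eq le_divide_eq mult_ac del: of_nat_Suc)
      qed
      finally have "\<bar>(\<Sum>k\<in>{1..x div d}. \<chi> k / k) - L\<bar> \<le> 2 * real N * d / x" .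
      moreover have "\<bar>\<chi> d * mangoldt d / d\<bar> \<le> mangoldt d / d"
        using abs_le_1[of d] mangoldt_nonneg[of d]
        by (simp add: abs_mult mult_left_le_one_le divide_right_mono)
      ultimately show "\<bar>\<chi> d * mangoldt d / d * ((\<Sum>k\<in>{1..x div d}. \<chi> k / k) - L)\<bar>
          \<le> mangoldt d / d * (2 * real N * d / x)"
        unfolding abs_mult[of "_ / _"] by (intro mult_mono) (auto simp: mangoldt_nonneg)
    qed
    also have "\<dots> = 2 * real N / x * (\<Sum>d\<in>{1..x}. mangoldt d)"
      by (simp add: sum_distrib_left sum_divide_distrib mult_ac)
    also have "\<dots> \<le> 2 * real N / x * (4 * x)"
      by (intro mult_left_mono sum_mangoldt_le) auto
    also have "\<dots> \<le> 8 * real N" by simp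
    finally have "\<bar>L * S\<bar> \<le> A + 8 * real N" using A[of x] by linarith
    then show "\<bar>\<Sum>d\<in>{1..x}. \<chi> d * mangoldt d / d\<bar> \<le> (A + 8 * real N) / \<bar>L\<bar>"
      unfolding S_def[symmetric] using L_nonzero by (simp add: abs_mult pos_le_divide_eq mult.commute)
  qed
qed

end

text \<open>The divergence for the principal character. The numbers \<open>Suc (j * N)\<close> with
  \<open>j < M\<close> are coprime to \<open>N\<close> and at least \<open>Suc j\<close>, so their
  logarithms already sum to at least \<open>ln (fact M)\<close>. Expanding the logarithms into
  \<open>mangoldt\<close> bounds the same sum above by \<open>M * N\<close> times the right-hand
  side.\<close>

lemma sum_mangoldt_coprime_ge:
  fixes N M :: nat
  assumes "0 < N" "0 < M"
  shows "(ln M - 1) / N \<le> (\<Sum>d\<in>{1..M * N}. of_bool (coprime d N) * mangoldt d / d)"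
proof -
  define x where "x = M * N"
  have "0 < x" using assms by (simp add: x_def)
  have "M * (ln M - 1) \<le> ln (fact M)" using ln_fact_ge[of M] by (simp add: right_diff_distrib)
  also have "\<dots> = (\<Sum>j<M. ln (real (Suc j)))"
    by (simp add: ln_fact_eq_sum_ln sum.atLeast1_atMost_eq)
  also have "\<dots> \<le> (\<Sum>j<M. ln (real (Suc (j * N))))"
  proof (intro sum_mono ln_mono)
    fix j
    have "Suc j \<le> Suc (j * N)" using assms by simp
    then show "real (Suc j) \<le> real (Suc (j * N))" by (simp only: of_nat_le_iff)
  qed auto
  also have "\<dots> = (\<Sum>n\<in>(\<lambda>j. Suc (j * N)) ` {..<M}. of_bool (coprime n N) * ln n)"
  proof -
    have coprime: "coprime (Suc (j * N)) N" for j
    proof (rule coprimeI)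
      fix c assume "c dvd Suc (j * N)" "c dvd N"
      moreover from \<open>c dvd N\<close> have "c dvd j * N" by simp
      ultimately show "is_unit c" using dvd_add_right_iff[of c "j * N" 1] by simp
    qed
    have "inj_on (\<lambda>j. Suc (j * N)) {..<M}" using assms by (intro inj_onI) simp
    then show ?thesis by (simp only: sum.reindex o_def coprime of_bool_eq mult_1)
  qed
  also have "\<dots> \<le> (\<Sum>n\<in>{1..x}. of_bool (coprime n N) * ln n)"
  proof (rule sum_mono2)
    have "Suc (j * N) \<le> M * N" if "j < M" for j
    proof -
      have "Suc j * N \<le> M * N" using that by (intro mult_right_mono) auto
      then show ?thesis using assms by simp
    qed
    then show "(\<lambda>j. Suc (j * N)) ` {..<M} \<subseteq> {1..x}" by (auto simp: x_def)
  qed auto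
  also have "\<dots> = (\<Sum>n\<in>{1..x}. \<Sum>d | d dvd n. of_bool (coprime d N) * mangoldt d * of_bool (coprime (n div d) N))"
  proof (intro sum.cong refl)
    fix n assume "n \<in> {1..x}"
    then have "of_bool (coprime n N) * ln (real n) = (\<Sum>d | d dvd n. of_bool (coprime n N) * mangoldt d)"
      by (simp add: mangoldt_sum sum_distrib_left[symmetric])
    also have "\<dots> = (\<Sum>d | d dvd n. of_bool (coprime d N) * mangoldt d * of_bool (coprime (n div d) N))"
      using \<open>n \<in> {1..x}\<close> by (intro sum.cong refl) (auto elim!: dvdE)
    finally show "of_bool (coprime n N) * ln (real n)
        = (\<Sum>d | d dvd n. of_bool (coprime d N) * mangoldt d * of_bool (coprime (n div d) N))" .
  qed
  also have "\<dots> = (\<Sum>d\<in>{1..x}. \<Sum>k\<in>{1..x div d}. of_bool (coprime d N) * mangoldt d * of_bool (coprime k N))"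
    by (rule sum_divisors_swap)
  also have "\<dots> \<le> (\<Sum>d\<in>{1..x}. of_bool (coprime d N) * mangoldt d * (x / d))"
  proof (rule sum_mono)
    fix d
    have "(\<Sum>k\<in>{1..x div d}. of_bool (coprime d N) * mangoldt d * of_bool (coprime k N))
        \<le> (\<Sum>k\<in>{1..x div d}. of_bool (coprime d N) * mangoldt d :: real)"
      by (intro sum_mono) (auto simp: mangoldt_nonneg)
    also have "\<dots> = of_bool (coprime d N) * mangoldt d * real (x div d)" by simp
    also have "\<dots> \<le> of_bool (coprime d N) * mangoldt d * (x / d)"
      using of_nat_div_le_of_nat[of x d] by (intro mult_left_mono) (auto simp: mangoldt_nonneg)
    finally show "(\<Sum>k\<in>{1..x div d}. of_bool (coprime d N) * mangoldt d * of_bool (coprime k N))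
        \<le> of_bool (coprime d N) * mangoldt d * (x / d)" .
  qed
  also have "\<dots> = x * (\<Sum>d\<in>{1..x}. of_bool (coprime d N) * mangoldt d / d)"
    by (simp add: sum_distrib_left mult_ac)
  finally have "M * (ln M - 1) \<le> M * (N * (\<Sum>d\<in>{1..x}. of_bool (coprime d N) * mangoldt d / d))"
    by (simp add: x_def mult.assoc)
  then have "ln M - 1 \<le> N * (\<Sum>d\<in>{1..x}. of_bool (coprime d N) * mangoldt d / d)"
    using assms by (simp add: mult_le_cancel_left_pos)
  then show ?thesis using assms by (simp add: x_def pos_divide_le_eq mult.commute)
qed

section \<open>Products of characters and detection of primes\<close>

lemma (in real_character) nonzero:
  assumes "coprime n N"
  shows "\<chi> n \<noteq> 0"
proof
  assume "\<chi> n = 0"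
  have "[n ^ totient N = 1] (mod N)" using assms by (rule euler_theorem)
  then have "\<chi> (n ^ totient N) = \<chi> 1"
    using mod_modulus[of "n ^ totient N"] mod_modulus[of 1] by (simp add: cong_def)
  moreover have "(0::real) ^ totient N = 0" using modulus_pos by (simp add: zero_power)
  ultimately show False using \<open>\<chi> n = 0\<close> one by (simp add: power)
qed

text \<open>The coprimality factor turns the empty product into the principal character, so that the
  products over all subsets of a family are characters modulo the same \<open>N\<close>.\<close>

lemma real_character_prod:
  assumes "\<And>i. i \<in> T \<Longrightarrow> real_character N (\<chi> i)" "0 < N"
  shows "real_character N (\<lambda>d. of_bool (coprime d N) * (\<Prod>i\<in>T. \<chi> i d))"
proof
  fix m n
  have char: "\<chi> i 1 = 1" "\<chi> i (m * n) = \<chi> i m * \<chi> i n" "\<chi> i (n + N) = \<chi> i n" "\<chi> i n \<in> {-1, 0, 1}"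
    if "i \<in> T" for i m n
    using that assms real_character.one[of N "\<chi> i"] real_character.mult[of N "\<chi> i"]
      real_character.periodic[of N "\<chi> i"] real_character.range[of N "\<chi> i"] by auto
  show "0 < N" by fact
  show "of_bool (coprime 1 N) * (\<Prod>i\<in>T. \<chi> i 1) = (1::real)" using char(1) by simp
  show "of_bool (coprime (m * n) N) * (\<Prod>i\<in>T. \<chi> i (m * n))
      = of_bool (coprime m N) * (\<Prod>i\<in>T. \<chi> i m) * (of_bool (coprime n N) * (\<Prod>i\<in>T. \<chi> i n))"
    using char(2) by (simp add: prod.distrib)
  show "of_bool (coprime (n + N) N) * (\<Prod>i\<in>T. \<chi> i (n + N)) = of_bool (coprime n N) * (\<Prod>i\<in>T. \<chi> i n)"
  proof -
    have "coprime (n + N) N = coprime n N" by (simp only: coprime_iff_gcd_eq_1 gcd_add1)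
    then show ?thesis using char(3) by simp
  qed
  have "(\<Prod>i\<in>T. \<chi> i n) \<in> {-1, 0, 1}"
    using char(4)[of _ n]
  proof (induction T rule: infinite_finite_induct)
    case (insert i T)
    then have "\<chi> i n \<in> {-1, 0, 1}" "(\<Prod>i\<in>T. \<chi> i n) \<in> {-1, 0, 1}" by blast+
    then show ?case using insert.hyps by auto
  qed auto
  then show "of_bool (coprime n N) * (\<Prod>i\<in>T. \<chi> i n) \<in> {-1, 0, 1}" by auto
qed

text \<open>
  Since some prescribed sign is \<open>-1\<close>, an even power of a prime never satisfies all prescriptions,
  and an odd power does so only if the prime itself does. Hence weighting by the von Mangoldt
  function detects primes without any separate estimate for proper prime powers.
\<close>
theorem exists_prime_with_signs:
  fixes \<chi> :: "'i \<Rightarrow> nat \<Rightarrow> real"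
  assumes "finite I" "0 < N"
    and char: "\<And>i. i \<in> I \<Longrightarrow> real_character N (\<chi> i)"
    and indep: "\<And>i. i \<in> I \<Longrightarrow> \<exists>a. coprime a N \<and> \<chi> i a = -1 \<and> (\<forall>j\<in>I - {i}. \<chi> j a = 1)"
    and signs: "\<And>i. i \<in> I \<Longrightarrow> \<epsilon> i \<in> {-1, 1}"
    and negative: "\<exists>i\<in>I. \<epsilon> i = -1"
  obtains q where "prime q" "coprime q N" "\<And>i. i \<in> I \<Longrightarrow> \<chi> i q = \<epsilon> i"
proof (rule ccontr)
  note found = that
  assume "\<not> thesis"
  then have no_prime: "\<exists>i\<in>I. \<chi> i q \<noteq> \<epsilon> i" if "prime q" "coprime q N" for q
    using found[of q] that \<open>\<not> thesis\<close> by blast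
  define \<psi> where "\<psi> T d = of_bool (coprime d N) * (\<Prod>i\<in>T. \<chi> i d)" for T d
  define S where "S T x = (\<Sum>d\<in>{1..x}. \<psi> T d * mangoldt d / d)" for T x
  have "\<exists>C. \<forall>x. \<bar>S T x\<bar> \<le> C" if T: "T \<subseteq> I" "T \<noteq> {}" for T
  proof -
    interpret real_character N "\<psi> T"
      unfolding \<psi>_def using T by (intro real_character_prod char \<open>0 < N\<close>) auto
    interpret nonprincipal_real_character N "\<psi> T"
    proof
      obtain i where i: "i \<in> T" using T by blast
      then obtain a where a: "coprime a N" "\<chi> i a = -1" "\<forall>j\<in>I - {i}. \<chi> j a = 1"
        using indep T by blast
      have "(\<Prod>j\<in>T. \<chi> j a) = \<chi> i a * (\<Prod>j\<in>T - {i}. \<chi> j a)"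
        using i T \<open>finite I\<close> by (intro prod.remove) (auto intro: finite_subset)
      also have "(\<Prod>j\<in>T - {i}. \<chi> j a) = 1" using a(3) T by (intro prod.neutral) auto
      finally show "\<exists>a. coprime a N \<and> \<psi> T a = -1" using a by (auto simp: \<psi>_def)
    qed
    show ?thesis unfolding S_def by (rule sum_mangoldt_bounded)
  qed
  then obtain C where C: "\<bar>S T x\<bar> \<le> C T" if "T \<subseteq> I" "T \<noteq> {}" for T x
    by metis
  \<comment> \<open>For \<open>d\<close> coprime to \<open>N\<close> every factor is 0 or 2, so the
    product detects the \<open>d\<close> with all prescribed signs. Expanding it over subsets of
    \<open>I\<close> writes it as a combination of the characters \<open>\<psi> T\<close>.\<close>
  have expand: "of_bool (coprime d N) * (\<Prod>i\<in>I. 1 + \<epsilon> i * \<chi> i d) = (\<Sum>T\<in>Pow I. (\<Prod>i\<in>T. \<epsilon> i) * \<psi> T d)" for d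
    using prod_add[OF \<open>finite I\<close>, of "\<lambda>i. \<epsilon> i * \<chi> i d" "\<lambda>_. 1"]
    by (simp add: add.commute prod.distrib \<psi>_def sum_distrib_left mult_ac)
  have vanish: "of_bool (coprime d N) * (\<Prod>i\<in>I. 1 + \<epsilon> i * \<chi> i d) * mangoldt d = 0" for d
  proof (cases "coprime d N \<and> primepow d")
    case True
    then obtain p k where p: "prime p" "0 < k" "d = p ^ k" by (auto simp: primepow_def)
    have "coprime p N" using True p by simp
    have sign: "\<chi> i p \<in> {-1, 1}" and power: "\<chi> i d = \<chi> i p ^ k" if "i \<in> I" for i
    proof -
      interpret real_character N "\<chi> i" using char that .
      show "\<chi> i p \<in> {-1, 1}" using range[of p] nonzero[OF \<open>coprime p N\<close>] by auto
      show "\<chi> i d = \<chi> i p ^ k" by (simp add: p power)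
    qed
    have "\<exists>i\<in>I. \<chi> i d \<noteq> \<epsilon> i"
    proof (cases "even k")
      case True
      then have "\<chi> i d = 1" if "i \<in> I" for i using sign[OF that] power[OF that] by auto
      then show ?thesis using negative by force
    next
      case False
      then have "\<chi> i d = \<chi> i p" if "i \<in> I" for i using sign[OF that] power[OF that] by auto
      then show ?thesis using no_prime[OF p(1) \<open>coprime p N\<close>] by auto
    qed
    then obtain i where "i \<in> I" "\<chi> i d \<noteq> \<epsilon> i" by blast
    moreover have "\<chi> i d \<in> {-1, 1}" using sign[OF \<open>i \<in> I\<close>] power[OF \<open>i \<in> I\<close>]
      by (cases "even k") auto
    ultimately have "1 + \<epsilon> i * \<chi> i d = 0" using signs by fastforce
    then have "(\<Prod>i\<in>I. 1 + \<epsilon> i * \<chi> i d) = 0" using \<open>i \<in> I\<close> \<open>finite I\<close> by (meson prod_zero)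
    then show ?thesis by simp
  qed (auto simp: mangoldt_def)
  \<comment> \<open>The detecting product kills every term, so the principal sum \<open>S {}\<close>
    is a combination, with coefficients of absolute value 1, of the bounded sums for nonempty
    \<open>T\<close>.\<close>
  have bound: "S {} x \<le> (\<Sum>T\<in>Pow I - {{}}. C T)" for x
  proof -
    have "0 = (\<Sum>d\<in>{1..x}. of_bool (coprime d N) * (\<Prod>i\<in>I. 1 + \<epsilon> i * \<chi> i d) * mangoldt d / d)"
      by (simp add: vanish)
    also have "\<dots> = (\<Sum>d\<in>{1..x}. \<Sum>T\<in>Pow I. (\<Prod>i\<in>T. \<epsilon> i) * (\<psi> T d * mangoldt d / d))"
      unfolding expand by (simp add: sum_distrib_left sum_divide_distrib mult_ac)
    also have "\<dots> = (\<Sum>T\<in>Pow I. (\<Prod>i\<in>T. \<epsilon> i) * S T x)"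
      unfolding S_def sum_distrib_left by (rule sum.swap)
    also have "\<dots> = S {} x + (\<Sum>T\<in>Pow I - {{}}. (\<Prod>i\<in>T. \<epsilon> i) * S T x)"
      using \<open>finite I\<close> by (subst sum.remove[of _ "{}"]) auto
    finally have "S {} x = (\<Sum>T\<in>Pow I - {{}}. - (\<Prod>i\<in>T. \<epsilon> i) * S T x)" by (simp add: sum_negf)
    also have "\<dots> \<le> (\<Sum>T\<in>Pow I - {{}}. C T)"
    proof (rule sum_mono)
      fix T assume T: "T \<in> Pow I - {{}}"
      have "\<bar>\<epsilon> i\<bar> = 1" if "i \<in> T" for i
      proof -
        have "i \<in> I" using T that by blast
        then show ?thesis using signs[of i] by auto
      qed
      then have "\<bar>\<Prod>i\<in>T. \<epsilon> i\<bar> = 1" by (simp add: abs_prod)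
      then have "\<bar>- (\<Prod>i\<in>T. \<epsilon> i) * S T x\<bar> = \<bar>S T x\<bar>" by (simp add: abs_mult)
      then show "- (\<Prod>i\<in>T. \<epsilon> i) * S T x \<le> C T" using C[of T x] T by auto
    qed
    finally show ?thesis .
  qed
  define B where "B = (\<Sum>T\<in>Pow I - {{}}. C T)"
  \<comment> \<open>\<open>M\<close> is chosen so large that \<open>(ln M - 1) / N\<close>, a lower
    bound for the principal sum, exceeds \<open>B + 1\<close>.\<close>
  obtain M :: nat where M: "exp (N * (B + 1) + 1) < M" using reals_Archimedean2 by blast
  then have "0 < M" using exp_gt_zero by (metis gr0I less_asym of_nat_0)
  have "N * (B + 1) + 1 < ln M" using M \<open>0 < M\<close> ln_less_cancel_iff[of "exp (N * (B + 1) + 1)" "real M"] by simp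
  then have "B + 1 \<le> (ln M - 1) / N" using \<open>0 < N\<close> by (simp add: pos_le_divide_eq mult.commute)
  also have "\<dots> \<le> S {} (M * N)"
    unfolding S_def \<psi>_def using sum_mangoldt_coprime_ge[OF \<open>0 < N\<close> \<open>0 < M\<close>] by simp
  also have "\<dots> \<le> B" unfolding B_def by (rule bound)
  finally show False by simp
qed

section \<open>Ternary forms\<close>

lemma nat_sqrt_bracket:
  fixes m :: nat
  obtains r where "r\<^sup>2 \<le> m" "m < (Suc r)\<^sup>2"
proof -
  have "\<exists>r. r\<^sup>2 \<le> m \<and> m < (Suc r)\<^sup>2"
  proof (induction m)
    case (Suc m)
    then obtain r where r: "r\<^sup>2 \<le> m" "m < (Suc r)\<^sup>2" by blast
    show ?case
    proof (cases "Suc m = (Suc r)\<^sup>2")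
      case True
      then have "(Suc r)\<^sup>2 \<le> Suc m \<and> Suc m < (Suc (Suc r))\<^sup>2" by (simp add: power2_eq_square)
      then show ?thesis by blast
    next
      case False
      then show ?thesis using r by (intro exI[of _ r]) auto
    qed
  qed (auto intro: exI[of _ 0])
  then show ?thesis using that by blast
qed

lemma abs_diff_square_le:
  fixes x y r :: nat
  assumes "x \<le> r" "y \<le> r"
  shows "(int x - int y)\<^sup>2 \<le> (int r)\<^sup>2"
proof -
  have "\<bar>int x - int y\<bar> \<le> \<bar>int r\<bar>" using assms by auto
  then show ?thesis by (simp only: abs_le_square_iff)
qed

text \<open>
  The congruences cut out a lattice of index \<open>n * q\<close> on which \<open>z\<^sup>2 + q * w\<^sup>2 - n * t\<^sup>2\<close> is divisible
  by \<open>n * q\<close>; a short vector takes the value \<open>0\<close> or \<open>n * q\<close>. In the latter case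
  \<open>z\<^sup>2 + q * w\<^sup>2 = n * (t\<^sup>2 + q)\<close>, and multiplying by the norm \<open>t\<^sup>2 + q\<close> gives a zero.
\<close>
lemma ternary_zero:
  fixes n q :: nat and \<alpha> \<beta> :: int
  assumes "0 < n" "0 < q" "coprime n q"
    and nonsquare: "\<And>s. s\<^sup>2 \<noteq> q"
    and \<alpha>: "[\<alpha>\<^sup>2 = int n] (mod int q)"
    and \<beta>: "[\<beta>\<^sup>2 = - int q] (mod int n)"
  shows "\<exists>z w t :: int. t \<noteq> 0 \<and> z\<^sup>2 + int q * w\<^sup>2 = int n * t\<^sup>2"
proof -
  obtain A where A: "A\<^sup>2 \<le> n * q" "n * q < (Suc A)\<^sup>2" by (rule nat_sqrt_bracket)
  obtain B where B: "B\<^sup>2 \<le> q" "q < (Suc B)\<^sup>2" by (rule nat_sqrt_bracket)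
  obtain D where D: "D\<^sup>2 \<le> n" "n < (Suc D)\<^sup>2" by (rule nat_sqrt_bracket)
  \<comment> \<open>The box has \<open>Suc A * Suc B * Suc D\<close> points. The square of this
    number exceeds \<open>(n * q) * q * n\<close>, so there are more points than the
    \<open>n * q\<close> residue pairs and two points agree under \<open>f\<close>.\<close>
  define X where "X = {..A} \<times> {..B} \<times> {..D}"
  define f where "f = (\<lambda>(z, t, w). ((int z - \<alpha> * int t) mod int q, (int z - \<beta> * int w) mod int n))"
  have "(n * q)\<^sup>2 = (n * q) * (q * n)" by (simp add: power2_eq_square)
  also have "\<dots> < (Suc A)\<^sup>2 * ((Suc B)\<^sup>2 * (Suc D)\<^sup>2)"
    using A B D by (intro mult_strict_mono) auto
  also have "\<dots> = (card X)\<^sup>2" by (simp only: X_def card_cartesian_product card_atMost power_mult_distrib)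
  finally have "n * q < card X" by (rule power_less_imp_less_base) simp
  moreover have "f ` X \<subseteq> {0..<int q} \<times> {0..<int n}" using assms by (auto simp: f_def)
  then have "card (f ` X) \<le> q * n"
    using card_mono[of "{0..<int q} \<times> {0..<int n}" "f ` X"] by (simp add: card_cartesian_product)
  ultimately have "\<not> inj_on f X" by (intro pigeonhole) (simp add: mult.commute)
  then obtain z1 t1 w1 z2 t2 w2 where 1: "(z1, t1, w1) \<in> X" "(z2, t2, w2) \<in> X"
    "(z1, t1, w1) \<noteq> (z2, t2, w2)" "f (z1, t1, w1) = f (z2, t2, w2)"
    unfolding inj_on_def by (metis prod_cases3)
  define z t w where "z = int z1 - int z2" and "t = int t1 - int t2" and "w = int w1 - int w2"
  define V where "V = z\<^sup>2 + int q * w\<^sup>2 - int n * t\<^sup>2"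
  have nz: "z \<noteq> 0 \<or> t \<noteq> 0 \<or> w \<noteq> 0" using 1(3) by (auto simp: z_def t_def w_def)
  have q_dvd: "int q dvd z - \<alpha> * t"
    using 1(4) by (simp add: f_def z_def t_def mod_eq_dvd_iff algebra_simps)
  have n_dvd: "int n dvd z - \<beta> * w"
    using 1(4) by (simp add: f_def z_def w_def mod_eq_dvd_iff algebra_simps)
  have "z\<^sup>2 \<le> int (A\<^sup>2)" "t\<^sup>2 \<le> int (B\<^sup>2)" "w\<^sup>2 \<le> int (D\<^sup>2)"
    using 1(1,2) by (auto simp: X_def z_def t_def w_def intro!: abs_diff_square_le)
  then have z: "z\<^sup>2 \<le> int (A\<^sup>2)" and t: "t\<^sup>2 \<le> int (B\<^sup>2)" and w: "w\<^sup>2 \<le> int (D\<^sup>2)" by auto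
  have V_dvd: "int n * int q dvd V"
  proof (rule divides_mult)
    have "int n dvd (z - \<beta> * w) * (z + \<beta> * w)" using n_dvd by simp
    moreover have "int n dvd \<beta>\<^sup>2 + int q" using \<beta> by (simp add: cong_iff_dvd_diff)
    moreover have "V = (z - \<beta> * w) * (z + \<beta> * w) + (\<beta>\<^sup>2 + int q) * w\<^sup>2 - int n * t\<^sup>2"
      by (simp add: V_def power2_eq_square algebra_simps)
    ultimately show "int n dvd V" by simp
    have "int q dvd (z - \<alpha> * t) * (z + \<alpha> * t)" using q_dvd by simp
    moreover have "int q dvd \<alpha>\<^sup>2 - int n" using \<alpha> by (simp add: cong_iff_dvd_diff)
    moreover have "V = (z - \<alpha> * t) * (z + \<alpha> * t) + (\<alpha>\<^sup>2 - int n) * t\<^sup>2 + int q * w\<^sup>2"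
      by (simp add: V_def power2_eq_square algebra_simps)
    ultimately show "int q dvd V" by simp
    show "coprime (int n) (int q)" using assms by simp
  qed
  have "z\<^sup>2 \<le> int (n * q)" using z A(1) by (metis of_nat_le_iff order_trans)
  moreover have w_le: "w\<^sup>2 \<le> int n" using w D(1) by (metis of_nat_le_iff order_trans)
  then have "int q * w\<^sup>2 \<le> int q * int n" by (intro mult_left_mono) auto
  moreover have "0 \<le> z\<^sup>2" "0 \<le> int q * w\<^sup>2" "0 \<le> int n * t\<^sup>2" by auto
  \<comment> \<open>Strictness comes from \<open>q\<close> not being a square; it keeps
    \<open>V\<close> strictly above \<open>- n * q\<close>.\<close>
  moreover have "B\<^sup>2 < q" using B(1) nonsquare[of B] by simp
  then have "t\<^sup>2 < int q" using t by (metis of_nat_less_iff le_less_trans)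
  then have "int n * t\<^sup>2 < int n * int q" using assms by (intro mult_strict_left_mono) auto
  \<comment> \<open>This value would turn both upper bounds into equalities, so that
    \<open>n = w^2\<close>, and then \<open>q\<close> would be the square of
    \<open>z / w\<close>.\<close>
  moreover have "z\<^sup>2 + int q * w\<^sup>2 \<noteq> 2 * (int n * int q)"
  proof
    assume "z\<^sup>2 + int q * w\<^sup>2 = 2 * (int n * int q)"
    then have *: "z\<^sup>2 = int n * int q" "int q * w\<^sup>2 = int q * int n"
      using \<open>z\<^sup>2 \<le> int (n * q)\<close> \<open>int q * w\<^sup>2 \<le> int q * int n\<close>
      unfolding of_nat_mult mult.commute[of "int q" "int n"] by linarith+
    then have "int n = w\<^sup>2" using assms by simp
    then have eq: "z\<^sup>2 = w\<^sup>2 * int q" and "w \<noteq> 0" using * assms by auto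
    then have "w dvd z" by (metis dvd_triv_left pow_divides_pow_iff zero_less_numeral)
    then obtain c where "z = w * c" by blast
    then have "c\<^sup>2 = int q" using eq \<open>w \<noteq> 0\<close> by (simp add: power_mult_distrib)
    then have "(nat \<bar>c\<bar>)\<^sup>2 = q" by (metis nat_int nat_power_eq abs_ge_zero power2_abs)
    then show False using nonsquare by blast
  qed
  ultimately have "- (int n * int q) < V" "V < 2 * (int n * int q)"
    unfolding V_def of_nat_mult mult.commute[of "int q" "int n"] by linarith+
  moreover obtain c where c: "V = int n * int q * c" using V_dvd by blast
  moreover have pos: "0 < int n * int q" using assms by simp
  ultimately have "int n * int q * (-1) < int n * int q * c" "int n * int q * c < int n * int q * 2" by auto
  then have "-1 < c" "c < 2" using pos by (simp_all only: mult_less_cancel_left_pos)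
  then consider "c = 0" | "c = 1" by linarith
  then show ?thesis
  proof cases
    case 1
    then have eq: "z\<^sup>2 + int q * w\<^sup>2 = int n * t\<^sup>2" using c by (simp add: V_def)
    moreover have "t \<noteq> 0"
    proof
      assume "t = 0"
      then have "z\<^sup>2 + int q * w\<^sup>2 = 0" using eq by simp
      then have "z\<^sup>2 = 0" "int q * w\<^sup>2 = 0"
        using \<open>0 \<le> z\<^sup>2\<close> \<open>0 \<le> int q * w\<^sup>2\<close> by linarith+
      then show False using nz \<open>t = 0\<close> \<open>0 < q\<close> by simp
    qed
    ultimately show ?thesis by blast
  next
    case 2
    then have eq: "z\<^sup>2 + int q * w\<^sup>2 = int n * (t\<^sup>2 + int q)" using c by (simp add: V_def algebra_simps)
    have "(z * t - int q * w)\<^sup>2 + int q * (z + w * t)\<^sup>2 = (z\<^sup>2 + int q * w\<^sup>2) * (t\<^sup>2 + int q)"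
      by (simp add: power2_eq_square algebra_simps)
    also have "\<dots> = int n * (t\<^sup>2 + int q)\<^sup>2" unfolding eq by (simp add: power2_eq_square)
    finally show ?thesis using \<open>0 < q\<close> by (metis add_nonneg_pos less_irrefl of_nat_0_less_iff zero_le_power2)
  qed
qed

text \<open>Thue's argument: on the lattice \<open>x = i * y\<close> modulo \<open>q\<close> the
  form \<open>x^2 + y^2\<close> is divisible by \<open>q\<close>. The box has more than
  \<open>q\<close> points, and a difference of two of them lying in the lattice satisfies
  \<open>0 < x^2 + y^2 < 2 * q\<close>.\<close>

lemma sum_two_squares:
  fixes q :: nat and i :: int
  assumes q: "prime q" and i: "[i\<^sup>2 = -1] (mod int q)"
  shows "\<exists>e f :: int. int q = e\<^sup>2 + f\<^sup>2"
proof -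
  have "0 < q" using q by (simp add: prime_gt_0_nat)
  obtain B where B: "B\<^sup>2 \<le> q" "q < (Suc B)\<^sup>2" by (rule nat_sqrt_bracket)
  have "B\<^sup>2 \<noteq> q" using q by (metis not_prime_1 one_power2 prime_power_iff numeral_eq_one_iff semiring_norm(85))
  define X where "X = {..B} \<times> {..B}"
  define f where "f = (\<lambda>(x, y). (int x - i * int y) mod int q)"
  have "f ` X \<subseteq> {0..<int q}" using \<open>0 < q\<close> by (auto simp: f_def)
  then have "card (f ` X) \<le> q" using card_mono[of "{0..<int q}" "f ` X"] by simp
  moreover have "q < card X" using B by (simp add: X_def card_cartesian_product power2_eq_square)
  ultimately have "\<not> inj_on f X" by (intro pigeonhole) simp
  then obtain x1 y1 x2 y2 where 1: "(x1, y1) \<in> X" "(x2, y2) \<in> X" "(x1, y1) \<noteq> (x2, y2)" "f (x1, y1) = f (x2, y2)"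
    unfolding inj_on_def by (metis surj_pair)
  define x y where "x = int x1 - int x2" and "y = int y1 - int y2"
  have "x\<^sup>2 \<le> int (B\<^sup>2)" "y\<^sup>2 \<le> int (B\<^sup>2)"
    using 1(1,2) by (auto simp: X_def x_def y_def intro!: abs_diff_square_le)
  moreover have "int (B\<^sup>2) < int q" using B(1) \<open>B\<^sup>2 \<noteq> q\<close> by linarith
  ultimately have less: "x\<^sup>2 + y\<^sup>2 < 2 * int q" by linarith
  have "x \<noteq> 0 \<or> y \<noteq> 0" using 1(3) by (auto simp: x_def y_def)
  then have pos: "0 < x\<^sup>2 + y\<^sup>2" by (simp add: sum_power2_gt_zero_iff)
  have "int q dvd x - i * y" using 1(4) by (simp add: f_def x_def y_def mod_eq_dvd_iff algebra_simps)
  then have "int q dvd (x - i * y) * (x + i * y)" by simp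
  moreover have "int q dvd i\<^sup>2 + 1" using i by (simp add: cong_iff_dvd_diff)
  moreover have "x\<^sup>2 + y\<^sup>2 = (x - i * y) * (x + i * y) + (i\<^sup>2 + 1) * y\<^sup>2"
    by (simp add: power2_eq_square algebra_simps)
  ultimately have "int q dvd x\<^sup>2 + y\<^sup>2" by simp
  then obtain c where c: "x\<^sup>2 + y\<^sup>2 = int q * c" by blast
  then have "int q * 0 < int q * c" "int q * c < int q * 2" using pos less by linarith+
  then have "c = 1" using \<open>0 < q\<close> by (simp only: mult_less_cancel_left_pos of_nat_0_less_iff)
  then show ?thesis using c by (metis mult_1_right)
qed

section \<open>Davenport-Cassels descent\<close>

lemma nearest_multiple:
  fixes x t :: int
  assumes "0 < t"
  obtains a where "4 * (x - t * a)\<^sup>2 \<le> t\<^sup>2"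
proof -
  \<comment> \<open>The quotient \<open>x / t\<close> rounded to a nearest integer, as the floor of
    \<open>x / t + 1 / 2\<close>.\<close>
  define a where "a = (2 * x + t) div (2 * t)"
  have "2 * x + t = 2 * t * a + (2 * x + t) mod (2 * t)" unfolding a_def by simp
  moreover have "0 \<le> (2 * x + t) mod (2 * t)" "(2 * x + t) mod (2 * t) < 2 * t" using assms by auto
  ultimately have "\<bar>2 * (x - t * a)\<bar> \<le> \<bar>t\<bar>" by (auto simp: algebra_simps)
  then have "(2 * (x - t * a))\<^sup>2 \<le> t\<^sup>2" by (simp only: abs_le_square_iff)
  moreover have "(2 * (x - t * a))\<^sup>2 = 4 * (x - t * a)\<^sup>2"
    by (simp only: power_mult_distrib) simp
  ultimately show ?thesis using that by metis
qed

text \<open>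
  The Davenport--Cassels descent: replace the rational point on the sphere by the second
  intersection of the sphere with the line through a nearest lattice point.
\<close>
lemma three_squares_descent:
  fixes n x y z t :: int
  assumes "0 < t" "n * t\<^sup>2 = x\<^sup>2 + y\<^sup>2 + z\<^sup>2"
  shows "\<exists>x y z. n = x\<^sup>2 + y\<^sup>2 + z\<^sup>2"
  using assms
proof (induction "nat t" arbitrary: x y z t rule: less_induct)
  case less
  obtain a where a: "4 * (x - t * a)\<^sup>2 \<le> t\<^sup>2" using nearest_multiple less.prems(1) by blast
  obtain b where b: "4 * (y - t * b)\<^sup>2 \<le> t\<^sup>2" using nearest_multiple less.prems(1) by blast
  obtain c where c: "4 * (z - t * c)\<^sup>2 \<le> t\<^sup>2" using nearest_multiple less.prems(1) by blast
  \<comment> \<open>\<open>d / t^2\<close> is the squared distance from the rational point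
    \<open>(x, y, z) / t\<close> to the lattice point \<open>(a, b, c)\<close>. Rounding makes it at
    most 3/4, hence \<open>d < t^2\<close>.\<close>
  define d where "d = (x - t * a)\<^sup>2 + (y - t * b)\<^sup>2 + (z - t * c)\<^sup>2"
  \<comment> \<open>The second intersection point has numerators \<open>N * x + M * a\<close>,
    \<open>N * y + M * b\<close>, \<open>N * z + M * c\<close> and denominator \<open>t'\<close>. As
    \<open>d = t * t'\<close>, the new denominator is positive and smaller, unless
    \<open>d = 0\<close> and the old point is already integral.\<close>
  define N where "N = a\<^sup>2 + b\<^sup>2 + c\<^sup>2 - n"
  define M where "M = 2 * (n * t - (x * a + y * b + z * c))"
  define t' where "t' = N * t + M"
  have "d = n * t\<^sup>2 - 2 * t * (x * a + y * b + z * c) + t\<^sup>2 * (a\<^sup>2 + b\<^sup>2 + c\<^sup>2)"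
    unfolding d_def less.prems(2) by (simp add: power2_eq_square algebra_simps)
  then have d: "d = t * t'" by (simp add: t'_def N_def M_def power2_eq_square algebra_simps)
  show ?case
  proof (cases "d = 0")
    case True
    then have "x - t * a = 0" "y - t * b = 0" "z - t * c = 0"
      unfolding d_def by (smt (verit) zero_le_power2 zero_eq_power2)+
    then have "n * t\<^sup>2 = (a\<^sup>2 + b\<^sup>2 + c\<^sup>2) * t\<^sup>2"
      using less.prems(2) by (simp add: power2_eq_square algebra_simps)
    then show ?thesis using less.prems(1) by auto
  next
    case False
    moreover have "0 \<le> d" unfolding d_def by simp
    ultimately have "0 < t * t'" using d by linarith
    then have "0 < t'" using less.prems(1) by (simp add: zero_less_mult_iff)
    have "0 < t\<^sup>2" using less.prems(1) by simp
    then have "t * t' < t * t" using a b c d unfolding d_def power2_eq_square[of t] by linarith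
    then have "t' < t" using less.prems(1) by (simp add: mult_less_cancel_left_pos)
    have "(N * x + M * a)\<^sup>2 + (N * y + M * b)\<^sup>2 + (N * z + M * c)\<^sup>2
        = N\<^sup>2 * (x\<^sup>2 + y\<^sup>2 + z\<^sup>2) + N * M * (2 * (x * a + y * b + z * c)) + M\<^sup>2 * (a\<^sup>2 + b\<^sup>2 + c\<^sup>2)"
      by (simp add: power2_eq_square algebra_simps)
    also have "\<dots> = N\<^sup>2 * (n * t\<^sup>2) + N * M * (2 * n * t - M) + M\<^sup>2 * (N + n)"
      unfolding less.prems(2) by (simp add: N_def M_def)
    also have "\<dots> = n * t'\<^sup>2" by (simp add: t'_def power2_eq_square algebra_simps)
    finally show ?thesis
      using less.hyps[of t'] \<open>0 < t'\<close> \<open>t' < t\<close> by (metis nat_less_eq_zless less_imp_le)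
  qed
qed

text \<open>A prime factor split off from a squarefree number is coprime to the cofactor, so the
  Chinese remainder theorem glues the two square roots.\<close>

lemma QuadRes_squarefree:
  fixes n :: nat
  assumes "squarefree n" "\<And>p. prime p \<Longrightarrow> p dvd n \<Longrightarrow> QuadRes (int p) a"
  shows "QuadRes (int n) a"
  using assms
proof (induction n rule: less_induct)
  case (less n)
  show ?case
  proof (cases "n = 1")
    case True
    then show ?thesis by (simp add: QuadRes_def)
  next
    case False
    then obtain p where p: "prime p" "p dvd n" using prime_factor_nat by blast
    then obtain m where m: "n = p * m" by blast
    have "n \<noteq> 0" using less.prems(1) by (metis not_squarefree_0)
    have "\<not> p dvd m"
    proof
      assume "p dvd m"
      then have "p\<^sup>2 dvd n" by (simp add: m power2_eq_square)
      then show False using squarefreeD[OF less.prems(1)] p(1) by (metis not_prime_unit)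
    qed
    then have sq: "squarefree m" "coprime p m"
      using less.prems(1) p(1) unfolding m by (auto dest: squarefree_multD intro: prime_imp_coprime)
    have "m < n" using m p \<open>n \<noteq> 0\<close> prime_gt_1_nat[of p] by (cases "m = 0") auto
    then have "QuadRes (int m) a" using less.IH[of m] less.prems(2) sq m by auto
    then obtain u where u: "[u\<^sup>2 = a] (mod int m)" by (auto simp: QuadRes_def)
    obtain v where v: "[v\<^sup>2 = a] (mod int p)" using less.prems(2)[OF p] by (auto simp: QuadRes_def)
    obtain x where x: "[x = v] (mod int p)" "[x = u] (mod int m)"
      using binary_chinese_remainder_int[of "int p" "int m" v u] sq by auto
    have "[x\<^sup>2 = a] (mod int p)" "[x\<^sup>2 = a] (mod int m)"
      using cong_trans[OF cong_pow[OF x(1)] v] cong_trans[OF cong_pow[OF x(2)] u] .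
    then have "[x\<^sup>2 = a] (mod int p * int m)"
      using sq by (intro coprime_cong_mult) auto
    then show ?thesis unfolding m QuadRes_def by auto
  qed
qed

section \<open>Quadratic characters\<close>

lemma Legendre_range: "Legendre a p \<in> {-1, 0, 1}"
  by (simp add: Legendre_def)

lemma Legendre_cong:
  assumes "[a = b] (mod p)"
  shows "Legendre a p = Legendre b p"
proof -
  have "[x = a] (mod p) \<longleftrightarrow> [x = b] (mod p)" for x using assms by (meson cong_sym cong_trans)
  moreover have "[a = 0] (mod p) \<longleftrightarrow> [b = 0] (mod p)" using assms by (meson cong_sym cong_trans)
  ultimately show ?thesis by (simp add: Legendre_def QuadRes_def)
qed

text \<open>Two such values differ by at most 2. This upgrades the congruences of Euler's criterion
  to equalities of Legendre symbols.\<close>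

lemma cong_signs_imp_eq:
  fixes a b :: int
  assumes "[a = b] (mod p)" "2 < p" "a \<in> {-1, 0, 1}" "b \<in> {-1, 0, 1}"
  shows "a = b"
proof -
  have "p dvd a - b" using assms by (simp add: cong_iff_dvd_diff)
  moreover have "\<bar>a - b\<bar> < p" using assms by auto
  ultimately show ?thesis using zdvd_imp_le by (metis abs_of_nonneg abs_ge_zero dvd_abs_iff eq_iff_diff_eq_0 less_le not_le zero_less_abs_iff)
qed

lemma Legendre_mult:
  assumes "prime p" "2 < p"
  shows "Legendre (a * b) (int p) = Legendre a (int p) * Legendre b (int p)"
proof (rule cong_signs_imp_eq)
  note euler = euler_criterion[OF assms]
  have "[Legendre a p * Legendre b p = a ^ ((p - 1) div 2) * b ^ ((p - 1) div 2)] (mod int p)"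
    by (intro cong_mult euler)
  then show "[Legendre (a * b) p = Legendre a p * Legendre b p] (mod int p)"
    using cong_trans[OF euler cong_sym] by (simp add: power_mult_distrib)
  show "Legendre a p * Legendre b p \<in> {-1, 0, 1}" using Legendre_range[of a p] Legendre_range[of b p] by auto
qed (use assms Legendre_range in auto)

lemma Legendre_1: "1 < p \<Longrightarrow> Legendre 1 (int p) = 1"
  unfolding Legendre_def QuadRes_def by (auto simp: cong_def intro: exI[of _ 1])

lemma of_int_sign: "a \<in> {-1, 0, 1} \<Longrightarrow> real_of_int a \<in> {-1, 0, 1}"
  by auto

text \<open>The nonprincipal character modulo 4, which at odd primes is the Legendre symbol of
  -1.\<close>

definition chi4 :: "nat \<Rightarrow> int" where
  "chi4 n = (if even n then 0 else if n mod 4 = 1 then 1 else -1)"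

text \<open>The Jacobi symbol (2/n), the character modulo 8 that decides whether 2 is a
  square.\<close>

definition chi8 :: "nat \<Rightarrow> int" where
  "chi8 n = (if even n then 0 else if n mod 8 = 1 \<or> n mod 8 = 7 then 1 else -1)"

lemma odd_mod_4: "odd n \<Longrightarrow> n mod 4 = 1 \<or> n mod 4 = 3" for n :: nat
  by presburger

lemma odd_mod_8: "odd n \<Longrightarrow> n mod 8 = 1 \<or> n mod 8 = 3 \<or> n mod 8 = 5 \<or> n mod 8 = 7" for n :: nat
  by presburger

lemma chi4_mult: "chi4 (m * n) = chi4 m * chi4 n"
proof (cases "even m \<or> even n")
  case False
  then have "m mod 4 = 1 \<or> m mod 4 = 3" "n mod 4 = 1 \<or> n mod 4 = 3" using odd_mod_4 by auto
  moreover have "m * n mod 4 = (m mod 4) * (n mod 4) mod 4" by (simp add: mod_mult_eq)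
  ultimately show ?thesis using False by (auto simp: chi4_def)
qed (auto simp: chi4_def)

lemma chi8_mult: "chi8 (m * n) = chi8 m * chi8 n"
proof (cases "even m \<or> even n")
  case False
  then have "m mod 8 = 1 \<or> m mod 8 = 3 \<or> m mod 8 = 5 \<or> m mod 8 = 7"
    "n mod 8 = 1 \<or> n mod 8 = 3 \<or> n mod 8 = 5 \<or> n mod 8 = 7" using odd_mod_8 by auto
  moreover have "m * n mod 8 = (m mod 8) * (n mod 8) mod 8" by (simp add: mod_mult_eq)
  ultimately show ?thesis using False by (elim disjE) (simp_all add: chi8_def)
qed (auto simp: chi8_def)

lemma Legendre_minus_1:
  assumes "prime p" "2 < p"
  shows "Legendre (-1) (int p) = chi4 p"
proof (rule cong_signs_imp_eq)
  have "odd p" using assms prime_odd_nat by blast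
  have "(-1::int) ^ ((p - 1) div 2) = chi4 p"
    using odd_mod_4[OF \<open>odd p\<close>]
  proof
    assume "p mod 4 = 1"
    then have "even ((p - 1) div 2)" by presburger
    then show ?thesis using \<open>p mod 4 = 1\<close> \<open>odd p\<close> by (simp add: chi4_def)
  next
    assume "p mod 4 = 3"
    then have "odd ((p - 1) div 2)" by presburger
    then show ?thesis using \<open>p mod 4 = 3\<close> \<open>odd p\<close> by (simp add: chi4_def)
  qed
  then show "[Legendre (-1) p = chi4 p] (mod int p)" using euler_criterion[OF assms, of "-1"] by simp
qed (use assms Legendre_range in \<open>auto simp: chi4_def\<close>)

lemma sqrt_minus_1:
  assumes "prime q" "q mod 4 = 1"
  obtains i where "[i\<^sup>2 = -1] (mod int q)"
proof -
  have "2 < q" using assms prime_gt_1_nat[of q] by (cases "q = 2") auto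
  have "odd q" using assms(2) by presburger
  then have "Legendre (-1) (int q) = 1" using Legendre_minus_1[OF assms(1) \<open>2 < q\<close>] assms(2) by (simp add: chi4_def)
  then show ?thesis using that by (auto simp: Legendre_def QuadRes_def split: if_splits)
qed

text \<open>Modulo \<open>q\<close> we have \<open>2 = (1 + i)\<^sup>2 * (- i)\<close> with \<open>i\<^sup>2 = -1\<close>, so \<open>2\<close> is a square iff \<open>- i\<close> is one.\<close>
lemma Legendre_2:
  assumes q: "prime q" "q mod 4 = 1"
  shows "Legendre 2 (int q) = chi8 q"
proof (rule cong_signs_imp_eq)
  obtain i where i: "[i\<^sup>2 = -1] (mod int q)" using sqrt_minus_1 q by blast
  have "2 < q" using q prime_gt_1_nat[of q] by (cases "q = 2") auto
  define h where "h = (q - 1) div 2"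
  have qh: "q - 1 = 2 * h" and "even h" using q(2) unfolding h_def by presburger+
  have two: "[2 = (1 + i)\<^sup>2 * (- i)] (mod int q)"
  proof -
    have "int q dvd i\<^sup>2 + 1" using i by (simp add: cong_iff_dvd_diff)
    then have "int q dvd (i\<^sup>2 + 1) * (2 + i)" by simp
    moreover have "(i\<^sup>2 + 1) * (2 + i) = 2 - (1 + i)\<^sup>2 * (- i)" by (simp add: power2_eq_square algebra_simps)
    ultimately show ?thesis by (simp add: cong_iff_dvd_diff)
  qed
  have "\<not> int q dvd 1 + i"
  proof
    assume "int q dvd 1 + i"
    then have "int q dvd (1 + i)\<^sup>2 * (- i)" by (simp add: power2_eq_square)
    then have "int q dvd 2" using two by (simp add: cong_dvd_iff)
    then show False using \<open>2 < q\<close> zdvd_imp_le[of "int q" 2] by simp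
  qed
  then have "(Legendre (1 + i) q)\<^sup>2 = 1" by (simp add: Legendre_def cong_0_iff)
  moreover have "[(1 + i) ^ h = Legendre (1 + i) q] (mod int q)"
    unfolding h_def using euler_criterion[OF q(1) \<open>2 < q\<close>] by (rule cong_sym)
  then have "[((1 + i) ^ h)\<^sup>2 = (Legendre (1 + i) q)\<^sup>2] (mod int q)" by (rule cong_pow)
  ultimately have "[(1 + i) ^ (q - 1) = 1] (mod int q)"
    unfolding qh by (simp add: power_mult[symmetric] mult.commute)
  \<comment> \<open>In the power with exponent \<open>h = (q - 1) / 2\<close> the square contributes
    \<open>(1 + i) ^ (q - 1)\<close>, which is 1. What remains is \<open>i ^ h\<close>, the power of
    -1 with exponent \<open>(q - 1) / 4\<close>, whose sign depends on \<open>q\<close> modulo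
    8.\<close>
  have "[Legendre 2 q = 2 ^ h] (mod int q)" unfolding h_def by (rule euler_criterion[OF q(1) \<open>2 < q\<close>])
  also have "[2 ^ h = ((1 + i)\<^sup>2 * (- i)) ^ h] (mod int q)" by (intro cong_pow two)
  also have "((1 + i)\<^sup>2 * (- i)) ^ h = (1 + i) ^ (q - 1) * i ^ h"
  proof -
    have "(- i) ^ h = i ^ h" using \<open>even h\<close> by simp
    then show ?thesis by (simp only: qh power_mult power_mult_distrib)
  qed
  also have "[\<dots> = 1 * i ^ h] (mod int q)" by (intro cong_mult cong_refl) fact
  also have "1 * i ^ h = (i\<^sup>2) ^ (h div 2)" using \<open>even h\<close> by (simp flip: power_mult)
  also have "[\<dots> = (-1) ^ (h div 2)] (mod int q)" by (intro cong_pow i)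
  also have "(-1) ^ (h div 2) = chi8 q"
  proof (cases "q mod 8 = 1")
    case True
    then obtain k where "q = 8 * k + 1" using mult_div_mod_eq[of 8 q] by metis
    then show ?thesis by (simp add: chi8_def h_def)
  next
    case False
    have "q mod 8 mod 4 = 1" using q(2) by (simp add: mod_mod_cancel)
    moreover have "odd q" using q \<open>2 < q\<close> prime_odd_nat by blast
    ultimately have "q mod 8 = 5" using odd_mod_8[of q] False by auto
    then obtain k where "q = 8 * k + 5" using mult_div_mod_eq[of 8 q] by metis
    then show ?thesis by (simp add: chi8_def h_def)
  qed
  finally show "[Legendre 2 (int q) = chi8 q] (mod int q)" .
  show "2 < int q" using \<open>2 < q\<close> by simp
  show "Legendre 2 (int q) \<in> {-1, 0, 1}" by (rule Legendre_range)
  show "chi8 q \<in> {-1, 0, 1}" by (simp add: chi8_def)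
qed

text \<open>Squaring takes the same value at 1 and \<open>p - 1\<close>, so it is not injective on
  the residues and hence misses one of them, which is nonzero because 0 is a square.\<close>

lemma exists_nonresidue:
  assumes "prime p" "2 < p"
  obtains g :: nat where "Legendre (int g) (int p) = -1"
proof -
  define f where "f = (\<lambda>y. y\<^sup>2 mod p)"
  have "f (p - 1) = f 1"
  proof -
    have "(p - 1)\<^sup>2 = 1 + p * (p - 2)" using assms(2)
      by (cases p rule: nat.exhaust; simp; cases "p - 1"; auto simp: power2_eq_square algebra_simps)
    then have "f (p - 1) = (1 + p * (p - 2)) mod p" by (simp only: f_def)
    also have "\<dots> = f 1" by (simp only: mod_mult_self2 f_def one_power2)
    finally show ?thesis .
  qed
  then have "\<not> inj_on f {..<p}"
    using inj_onD[of f "{..<p}" "p - 1" 1] assms by fastforce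
  moreover have "f ` {..<p} \<subseteq> {..<p}" using assms by (auto simp: f_def)
  ultimately obtain g where g: "g < p" "g \<notin> f ` {..<p}"
    using eq_card_imp_inj_on[of "{..<p}" f] by (metis finite_lessThan lessThan_iff subset_antisym subsetI)
  have "\<not> QuadRes (int p) (int g)"
  proof
    assume "QuadRes (int p) (int g)"
    then obtain y where y: "[y\<^sup>2 = int g] (mod int p)" by (auto simp: QuadRes_def)
    define x where "x = nat (y mod int p)"
    have x: "int x = y mod int p" "x < p" using assms by (auto simp: x_def nat_less_iff)
    have "int (x\<^sup>2 mod p) = y\<^sup>2 mod int p" by (simp add: zmod_int x(1) power_mod)
    also have "\<dots> = int g" using y g by (simp add: cong_def)
    finally have "f x = g" by (simp only: f_def of_nat_eq_iff)
    then show False using g x by auto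
  qed
  moreover have "0 \<in> f ` {..<p}" using assms by (intro image_eqI[of _ f 0]) (simp_all add: f_def)
  then have "g \<noteq> 0" using g(2) by metis
  then have "\<not> [int g = 0] (mod int p)" using g by (simp add: cong_def)
  ultimately show ?thesis using that[of g] by (simp add: Legendre_def)
qed

section \<open>Legendre symbols, \<open>chi4\<close> and \<open>chi8\<close> as real
  characters\<close>

lemma real_character_Legendre:
  assumes "prime p" "2 < p" "p dvd N" "0 < N"
  shows "real_character N (\<lambda>n. of_int (Legendre (int n) (int p)))"
proof
  fix m n
  show "real_of_int (Legendre (int (n + N)) (int p)) = of_int (Legendre (int n) (int p))"
  proof -
    have "[int (n + N) = int n] (mod int p)" using assms(3) by (simp add: cong_iff_dvd_diff)
    then show ?thesis using Legendre_cong by metis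
  qed
  show "real_of_int (Legendre (int n) (int p)) \<in> {-1, 0, 1}"
    by (intro of_int_sign Legendre_range)
qed (use assms Legendre_1[of p] in \<open>simp_all add: Legendre_mult\<close>)

lemma real_character_chi4:
  assumes "8 dvd N" "0 < N"
  shows "real_character N (\<lambda>n. of_int (chi4 n))"
proof
  fix n
  obtain k where "N = 4 * (2 * k)" using assms(1) by (auto elim!: dvdE)
  then have "even (n + N) = even n" "(n + N) mod 4 = n mod 4" by (simp_all only: mod_mult_self2) simp
  then show "real_of_int (chi4 (n + N)) = of_int (chi4 n)" by (simp add: chi4_def)
  show "real_of_int (chi4 n) \<in> {-1, 0, 1}" by (simp add: chi4_def)
qed (use assms in \<open>simp_all add: chi4_mult\<close>, simp add: chi4_def)

lemma real_character_chi8: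
  assumes "8 dvd N" "0 < N"
  shows "real_character N (\<lambda>n. of_int (chi8 n))"
proof
  fix n
  have "even (n + N) = even n" "(n + N) mod 8 = n mod 8" using assms(1) by (auto elim!: dvdE)
  then show "real_of_int (chi8 (n + N)) = of_int (chi8 n)" by (simp add: chi8_def)
  show "real_of_int (chi8 n) \<in> {-1, 0, 1}" by (simp add: chi8_def)
qed (use assms in \<open>simp_all add: chi8_mult\<close>, simp add: chi8_def)

text \<open>This carries quadratic reciprocity from the prime factors of an odd number to the number
  itself.\<close>

lemma multiplicative_eqI:
  fixes f g :: "nat \<Rightarrow> 'a :: monoid_mult"
  assumes f: "f 1 = 1" "\<And>m n. f (m * n) = f m * f n"
    and g: "g 1 = 1" "\<And>m n. g (m * n) = g m * g n"
    and eq: "\<And>p. prime p \<Longrightarrow> p dvd n \<Longrightarrow> f p = g p" and "0 < n"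
  shows "f n = g n"
  using eq \<open>0 < n\<close>
proof (induction n rule: less_induct)
  case (less n)
  show ?case
  proof (cases "n = 1")
    case False
    then obtain p where p: "prime p" "p dvd n" using prime_factor_nat by blast
    then obtain m where m: "n = p * m" by blast
    then have "m < n" "0 < m" using p less.prems(2) prime_gt_1_nat[of p] by auto
    then have "f m = g m" using less.IH less.prems(1) m by auto
    then show ?thesis using m f g less.prems(1)[OF p] by simp
  qed (simp only: f g)
qed


text \<open>Prescribe \<open>chi4 q = 1\<close> and, for odd primes \<open>p\<close> dividing
  \<open>n\<close>, that \<open>q\<close> has the same Legendre symbol modulo \<open>p\<close> as
  -1; then \<open>- q\<close> is a square modulo \<open>p\<close>. Reciprocity makes the symbol of
  the odd part \<open>m\<close> modulo \<open>q\<close> equal to \<open>chi4 m\<close>. This is 1 if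
  \<open>n = m\<close>, and if \<open>n = 2 * m\<close> it is cancelled by the symbol of 2, since
  \<open>chi8 q = chi4 m\<close> is prescribed as well.\<close>

theorem exists_prime_for_ternary:
  fixes n :: nat
  assumes "squarefree n" "n mod 4 = 1 \<or> n mod 4 = 2"
  obtains q where "prime q" "q mod 4 = 1" "coprime n q"
    "QuadRes (int n) (- int q)" "QuadRes (int q) (int n)"
proof -
  have "0 < n" using assms(1) by (metis not_squarefree_0 gr0I)
  \<comment> \<open>An odd prime not dividing \<open>n\<close>. Its sign is set to -1 to supply the
    negative prescription that \<open>exists_prime_with_signs\<close> requires.\<close>
  obtain r where r: "prime r" "n + 2 < r" using bigger_prime by blast
  define N where "N = 8 * n * r"
  have "0 < N" using \<open>0 < n\<close> r by (simp add: N_def prime_gt_0_nat)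
  define P where "P = {p. prime p \<and> 2 < p \<and> p dvd n * r}"
  have "0 < n * r" using \<open>0 < n\<close> r by simp
  then have "finite P" unfolding P_def
    by (intro finite_subset[OF _ finite_divisors_nat[of "n * r"]]) auto
  define m where "m = (if odd n then n else n div 2)"
  have m: "odd m" "n = m \<or> n = 2 * m" using assms(2) by (auto simp: m_def)
  \<comment> \<open>The indices 4 and 8 stand for \<open>chi4\<close> and \<open>chi8\<close>, the
    others for Legendre symbols; there is no clash because all members of \<open>P\<close> are
    odd.\<close>
  define \<chi> :: "nat \<Rightarrow> nat \<Rightarrow> int" where
    "\<chi> i d = (if i = 4 then chi4 d else if i = 8 then chi8 d else Legendre (int d) (int i))" for i d
  define \<epsilon> :: "nat \<Rightarrow> int" where
    "\<epsilon> i = (if i = 4 then 1 else if i = 8 then chi4 m else if i = r then -1 else chi4 i)" for i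
  define I where "I = P \<union> {4, 8}"
  have odd_P: "odd p" if "p \<in> P" for p using that prime_odd_nat by (auto simp: P_def)
  then have P_not: "4 \<notin> P" "8 \<notin> P" by force+
  have char: "real_character N (\<lambda>d. real_of_int (\<chi> i d))" if "i \<in> I" for i
  proof -
    have "8 dvd N" "\<And>p. p dvd n * r \<Longrightarrow> p dvd N" by (auto simp: N_def mult.assoc)
    moreover have "i = 4 \<or> i = 8 \<or> (i \<noteq> 4 \<and> i \<noteq> 8 \<and> i \<in> P)"
      using that P_not unfolding I_def by auto
    ultimately show ?thesis
      using \<open>0 < N\<close> real_character_chi4 real_character_chi8 real_character_Legendre
      by (auto simp: \<chi>_def P_def)
  qed
  have indep: "\<exists>a. coprime a N \<and> real_of_int (\<chi> i a) = -1 \<and> (\<forall>j\<in>I - {i}. real_of_int (\<chi> j a) = 1)"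
    if "i \<in> I" for i
  proof -
    have "\<exists>g. \<forall>p\<in>P. Legendre (int (g p)) (int p) = -1"
    proof (rule bchoice, rule ballI)
      fix p assume "p \<in> P"
      then show "\<exists>g. Legendre (int g) (int p) = -1"
        using exists_nonresidue[of p] by (auto simp: P_def)
    qed
    then obtain g where g: "Legendre (int (g p)) (int p) = -1" if "p \<in> P" for p by blast
    \<comment> \<open>Modulo 8, the residue 7 flips only \<open>chi4\<close> and 5 flips only
      \<open>chi8\<close>; a nonresidue modulo the prime \<open>i\<close> flips only that Legendre
      symbol. All other moduli get residue 1.\<close>
    define u where "u p = (if p = 8 then if i = 4 then 7 else if i = 8 then 5 else 1
      else if p = i then g p else 1)" for p
    have "\<exists>a. \<forall>p\<in>insert 8 P. [a = u p] (mod p)"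
    proof (rule chinese_remainder_nat)
      show "finite (insert 8 P)" using \<open>finite P\<close> by simp
      have "coprime 8 p" if "p \<in> P" for p
        using odd_P[OF that] coprime_power_left_iff[of 2 3 p] by simp
      moreover have "coprime p p'" if "p \<in> P" "p' \<in> P" "p \<noteq> p'" for p p'
        using that by (auto simp: P_def primes_coprime)
      ultimately show "\<forall>i\<in>insert 8 P. \<forall>j\<in>insert 8 P. i \<noteq> j \<longrightarrow> coprime i j"
        by (auto simp: coprime_commute)
    qed
    then obtain a where a: "[a = u p] (mod p)" if "p \<in> insert 8 P" for p by blast
    have a8: "a mod 8 = (if i = 4 then 7 else if i = 8 then 5 else 1)"
      using a[of 8] by (simp add: cong_def u_def split: if_splits)
    then have "odd a" "a mod 4 = (if i = 4 then 3 else 1)" by (cases "i = 4"; cases "i = 8"; simp; presburger)+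
    then have c4: "chi4 a = (if i = 4 then -1 else 1)" and c8: "chi8 a = (if i = 8 then -1 else 1)"
      using a8 by (auto simp: chi4_def chi8_def)
    have leg: "Legendre (int a) (int p) = (if p = i then -1 else 1)" if "p \<in> P" for p
    proof -
      have "[int a = int (u p)] (mod int p)" using a that by (simp add: cong_int_iff)
      then have "Legendre (int a) (int p) = Legendre (int (u p)) (int p)" by (rule Legendre_cong)
      then show ?thesis using g[OF that] that P_not(2) Legendre_1[of p]
        by (auto simp: u_def P_def)
    qed
    have "coprime a N"
    proof (rule ccontr)
      assume "\<not> coprime a N"
      then have "gcd a N \<noteq> 1" by (simp only: coprime_iff_gcd_eq_1 not_False_eq_True)
      then obtain p where "prime p" "p dvd gcd a N" using prime_factor_nat by blast
      then have p: "prime p" "p dvd a" "p dvd N" by simp_all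
      show False
      proof (cases "p = 2")
        case True
        then show False using p \<open>odd a\<close> by simp
      next
        case False
        then have "2 < p" using p(1) prime_gt_1_nat[of p] by simp
        moreover have "\<not> p dvd 8" using p(1) False prime_dvd_power[of p 2 3] by (auto simp: primes_dvd_imp_eq)
        ultimately have "p \<in> P" using p unfolding P_def N_def by (simp add: prime_dvd_mult_iff mult.assoc)
        then have "Legendre (int a) (int p) \<noteq> 0" using leg by auto
        then show False using p(2) by (simp add: Legendre_def cong_0_iff)
      qed
    qed
    moreover have "\<chi> j a = (if j = i then -1 else 1)" if "j \<in> I" for j
      using that \<open>i \<in> I\<close> c4 c8 leg P_not unfolding \<chi>_def I_def by auto
    ultimately show ?thesis using that by (intro exI[of _ a]) auto
  qed
  have "r \<in> P" using r \<open>0 < n\<close> by (auto simp: P_def)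
  have signs: "real_of_int (\<epsilon> i) \<in> {-1, 1}" if "i \<in> I" for i
    using that m odd_P by (auto simp: \<epsilon>_def chi4_def I_def)
  have "r \<noteq> 4" "r \<noteq> 8" using P_not \<open>r \<in> P\<close> by auto
  then have "\<exists>i\<in>I. real_of_int (\<epsilon> i) = -1" using \<open>r \<in> P\<close> by (intro bexI[of _ r]) (auto simp: \<epsilon>_def I_def)
  then obtain q where q: "prime q" "coprime q N"
    and sign: "\<And>i. i \<in> I \<Longrightarrow> real_of_int (\<chi> i q) = real_of_int (\<epsilon> i)"
    using exists_prime_with_signs[where I = I and N = N and \<chi> = "\<lambda>i d. real_of_int (\<chi> i d)"
        and \<epsilon> = "\<lambda>i. real_of_int (\<epsilon> i)", OF _ \<open>0 < N\<close> char indep signs] \<open>finite P\<close>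
    unfolding I_def by blast
  have "chi4 q = 1" using sign[of 4] by (simp add: \<chi>_def \<epsilon>_def I_def)
  then have q4: "q mod 4 = 1" by (auto simp: chi4_def split: if_splits)
  have q8: "chi8 q = chi4 m" using sign[of 8] by (simp add: \<chi>_def \<epsilon>_def I_def)
  have "2 < q" using q4 q(1) prime_gt_1_nat[of q] by (cases "q = 2") auto
  have "coprime n q" using q(2) by (simp add: N_def coprime_commute)
  have leg: "Legendre (int q) (int p) = chi4 p" if "prime p" "2 < p" "p dvd n" for p
  proof -
    have "p \<in> P" using that by (simp add: P_def)
    moreover have "p \<noteq> r" using dvd_imp_le[OF that(3) \<open>0 < n\<close>] r(2) by linarith
    moreover have "p \<noteq> 4" "p \<noteq> 8" using P_not \<open>p \<in> P\<close> by metis+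
    ultimately show ?thesis using sign[of p] by (simp add: \<chi>_def \<epsilon>_def I_def)
  qed
  have "QuadRes (int n) (- int q)"
  proof (rule QuadRes_squarefree[OF assms(1)])
    fix p assume p: "prime p" "p dvd n"
    show "QuadRes (int p) (- int q)"
    proof (cases "p = 2")
      case True
      have "odd q" using q4 by presburger
      then have "[1\<^sup>2 = - int q] (mod int p)" unfolding True cong_iff_dvd_diff by simp
      then show ?thesis unfolding QuadRes_def by blast
    next
      case False
      then have "2 < p" using p(1) prime_gt_1_nat[of p] by simp
      have "Legendre (- int q) (int p) = Legendre (-1) (int p) * Legendre (int q) (int p)"
        using Legendre_mult[OF p(1) \<open>2 < p\<close>, of "-1" "int q"] by simp
      also have "\<dots> = chi4 p * chi4 p" using Legendre_minus_1 leg p \<open>2 < p\<close> by simp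
      also have "\<dots> = 1" using p(1) \<open>2 < p\<close> prime_odd_nat by (auto simp: chi4_def)
      finally show ?thesis by (simp add: Legendre_def split: if_splits)
    qed
  qed
  moreover have "QuadRes (int q) (int n)"
  proof -
    have "Legendre (int m) (int q) = chi4 m"
    proof (rule multiplicative_eqI)
      fix p assume p: "prime p" "p dvd m"
      have "p \<noteq> 2" "p dvd n" using p m by auto
      then have "2 < p" using p(1) prime_gt_1_nat[of p] by simp
      have "p \<noteq> q" using \<open>coprime n q\<close> \<open>p dvd n\<close> p(1) by (metis coprime_common_divisor dvd_refl not_prime_unit)
      \<comment> \<open>Since \<open>q\<close> is 1 modulo 4, the sign in quadratic reciprocity is
        positive.\<close>
      have "even ((q - 1) div 2)" using q4 by presburger
      then have "Legendre (int p) (int q) * Legendre (int q) (int p) = 1"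
        using Quadratic_Reciprocity[OF p(1) \<open>2 < p\<close> q(1) \<open>2 < q\<close> \<open>p \<noteq> q\<close>] by simp
      moreover have "Legendre (int q) (int p) = chi4 p" using leg p \<open>p dvd n\<close> \<open>2 < p\<close> by simp
      ultimately show "Legendre (int p) (int q) = chi4 p" by (auto simp: chi4_def split: if_splits)
    qed (use m q \<open>2 < q\<close> Legendre_1[of q] in \<open>auto simp: Legendre_mult chi4_mult odd_pos\<close>, auto simp: chi4_def)
    have "Legendre (int n) (int q) = 1"
      using m(2)
    proof
      assume "n = m"
      then have "n mod 4 = 1" using m(1) assms(2) by presburger
      then have "chi4 m = 1" using m(1) \<open>n = m\<close> by (simp add: chi4_def)
      then show ?thesis using \<open>Legendre (int m) (int q) = chi4 m\<close> \<open>n = m\<close> by simp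
    next
      assume "n = 2 * m"
      then have "Legendre (int n) (int q) = Legendre 2 (int q) * Legendre (int m) (int q)"
        using Legendre_mult[OF q(1) \<open>2 < q\<close>] by simp
      also have "\<dots> = chi4 m * chi4 m" using Legendre_2[OF q(1) q4] q8 \<open>Legendre (int m) (int q) = chi4 m\<close> by simp
      also have "\<dots> = 1" using m(1) by (simp add: chi4_def)
      finally show ?thesis .
    qed
    then show ?thesis by (simp add: Legendre_def split: if_splits)
  qed
  ultimately show ?thesis using that q(1) q4 \<open>coprime n q\<close> by blast
qed

section \<open>The three-squares theorem\<close>

lemma three_squares_squarefree:
  fixes n :: nat
  assumes "squarefree n" "n mod 4 = 1 \<or> n mod 4 = 2"
  shows "\<exists>x y z :: int. int n = x\<^sup>2 + y\<^sup>2 + z\<^sup>2"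
proof -
  obtain q where q: "prime q" "q mod 4 = 1" "coprime n q"
    "QuadRes (int n) (- int q)" "QuadRes (int q) (int n)"
    using exists_prime_for_ternary[OF assms] .
  obtain \<alpha> \<beta> where "[\<alpha>\<^sup>2 = int n] (mod int q)" "[\<beta>\<^sup>2 = - int q] (mod int n)"
    using q(4,5) by (auto simp: QuadRes_def)
  moreover have "s\<^sup>2 \<noteq> q" for s
    using q(1) by (metis not_prime_1 one_power2 prime_power_iff numeral_eq_one_iff semiring_norm(85))
  moreover have "0 < n" using assms(1) by (metis not_squarefree_0 gr0I)
  ultimately obtain z w t :: int where zwt: "t \<noteq> 0" "z\<^sup>2 + int q * w\<^sup>2 = int n * t\<^sup>2"
    using ternary_zero[of n q] q prime_gt_0_nat by blast
  \<comment> \<open>With \<open>q = e^2 + f^2\<close> the term \<open>q * w^2\<close> becomes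
    \<open>(e * w)^2 + (f * w)^2\<close>, so \<open>n * t^2\<close> is a sum of three squares and
    the descent applies.\<close>
  obtain e f :: int where "int q = e\<^sup>2 + f\<^sup>2"
    using sqrt_minus_1[OF q(1,2)] sum_two_squares[OF q(1)] by metis
  then have "int n * \<bar>t\<bar>\<^sup>2 = z\<^sup>2 + (e * w)\<^sup>2 + (f * w)\<^sup>2"
    using zwt(2) by (simp add: power2_eq_square algebra_simps)
  then show ?thesis using three_squares_descent[of "\<bar>t\<bar>"] zwt(1) by simp
qed

text \<open>As 4 does not divide \<open>n\<close>, the square part \<open>k\<close> is odd and
  \<open>k^2\<close> is 1 modulo 4. So the squarefree part lies in the same class modulo 4 as
  \<open>n\<close>, and its representation scales by \<open>k\<close>.\<close>

theorem three_squares: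
  fixes n :: nat
  assumes "n mod 4 = 1 \<or> n mod 4 = 2"
  shows "\<exists>x y z :: int. int n = x\<^sup>2 + y\<^sup>2 + z\<^sup>2"
proof -
  define s k where "s = squarefree_part n" and "k = square_part n"
  have n: "n = s * k\<^sup>2" unfolding s_def k_def by (rule squarefree_decompose)
  have "odd k"
  proof
    assume "even k"
    then obtain j where "k = 2 * j" by blast
    then have "n mod 4 = 0" unfolding n by (simp add: power2_eq_square)
    then show False using assms by simp
  qed
  then have "k\<^sup>2 mod 4 = 1"
  proof -
    obtain j where "k = 2 * j + 1" using \<open>odd k\<close> oddE by blast
    then have "k\<^sup>2 = 1 + 4 * (j\<^sup>2 + j)" by (simp add: power2_eq_square algebra_simps)
    then show ?thesis by simp
  qed
  then have "n mod 4 = s mod 4" unfolding n by (metis mod_mult_right_eq mult_1_right)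
  then obtain x y z :: int where "int s = x\<^sup>2 + y\<^sup>2 + z\<^sup>2"
    using three_squares_squarefree[of s] assms unfolding s_def by auto
  then have "int n = (k * x)\<^sup>2 + (k * y)\<^sup>2 + (k * z)\<^sup>2"
    unfolding n by (simp add: power_mult_distrib algebra_simps)
  then show ?thesis by blast
qed


section \<open>The quaternary form\<close>

text \<open>Two of the three numbers have equal parity, and for these \<open>x^2 + y^2\<close> is
  twice the sum of the squares of \<open>(x + y) / 2\<close> and \<open>(x - y) / 2\<close>.\<close>

lemma three_squares_parity:
  fixes x y z :: int
  assumes "m = x\<^sup>2 + y\<^sup>2 + z\<^sup>2"
  obtains a b c where "m = 2 * a\<^sup>2 + 2 * b\<^sup>2 + c\<^sup>2"
proof -
  note found = that
  have split: thesis if "m = x\<^sup>2 + y\<^sup>2 + z\<^sup>2" "even (x + y)" for x y z :: int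
  proof -
    from that(2) obtain a where "x + y = 2 * a" by blast
    then have x: "x = 2 * a - y" by simp
    have "m = 2 * a\<^sup>2 + 2 * (a - y)\<^sup>2 + z\<^sup>2"
      unfolding that(1) x by (simp add: power2_eq_square algebra_simps)
    then show thesis by (rule found)
  qed
  have "even (x + y) \<or> even (x + z) \<or> even (y + z)" by presburger
  then show thesis using split[of x y z] split[of x z y] split[of y z x] assms by auto
qed

text \<open>Factors 4 are scaled away. For odd \<open>n\<close>, three squares for
  \<open>2 * n\<close> lead to \<open>n = a^2 + b^2 + 2 * d^2\<close>, where \<open>a\<close> or
  \<open>b\<close> is even. For \<open>n = 2 * h\<close> with \<open>h\<close> odd, \<open>h\<close>
  or \<open>h - 6\<close> is 1 modulo 4 and is written as \<open>2 * a^2 + 2 * b^2 + c^2\<close>;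
  the case \<open>h = 3\<close>, too small for the subtraction, is done by hand.\<close>

lemma form_universal:
  "\<exists>x y z w :: int. int n = x\<^sup>2 + 2 * y\<^sup>2 + 4 * (z\<^sup>2 + z * w + w\<^sup>2)"
proof (induction n rule: less_induct)
  case (less n)
  have "n = 0 \<or> (0 < n \<and> 4 dvd n) \<or> odd n \<or> n mod 4 = 2" by presburger
  then consider "n = 0" | "0 < n" "4 dvd n" | "odd n" | "n mod 4 = 2" by blast
  then show ?case
  proof cases
    case 1
    then show ?thesis by (intro exI[of _ 0]) simp
  next
    case 2
    then obtain m where m: "n = 4 * m" "m < n" by (auto elim!: dvdE)
    then obtain x y z w where "int m = x\<^sup>2 + 2 * y\<^sup>2 + 4 * (z\<^sup>2 + z * w + w\<^sup>2)" using less by blast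
    then have "int n = (2 * x)\<^sup>2 + 2 * (2 * y)\<^sup>2 + 4 * ((2 * z)\<^sup>2 + 2 * z * (2 * w) + (2 * w)\<^sup>2)"
      using m by (simp add: power2_eq_square algebra_simps)
    then show ?thesis by blast
  next
    case 3
    then have "2 * n mod 4 = 2" by presburger
    then obtain x y z :: int where "int (2 * n) = x\<^sup>2 + y\<^sup>2 + z\<^sup>2" using three_squares by blast
    then obtain a b c :: int where abc: "int (2 * n) = 2 * a\<^sup>2 + 2 * b\<^sup>2 + c\<^sup>2"
      by (rule three_squares_parity)
    then have "c\<^sup>2 = 2 * (int n - a\<^sup>2 - b\<^sup>2)" by simp
    then have "even (c\<^sup>2)" by (metis dvd_triv_left)
    then obtain d where d: "c = 2 * d" by auto
    have eq: "int n = a\<^sup>2 + b\<^sup>2 + 2 * d\<^sup>2" using abc unfolding d by (simp add: power_mult_distrib)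
    have "odd (int n)" using 3 by simp
    then have "even a \<or> even b" unfolding eq by auto
    then obtain e u where "a\<^sup>2 + b\<^sup>2 = e\<^sup>2 + (2 * u)\<^sup>2" by (metis add.commute dvd_def)
    then have "int n = e\<^sup>2 + 2 * d\<^sup>2 + 4 * (u\<^sup>2 + u * 0 + 0\<^sup>2)"
      unfolding eq by (simp add: power_mult_distrib)
    then show ?thesis by blast
  next
    case 4
    define h where "h = n div 2"
    have n: "n = 2 * h" and "odd h" using 4 unfolding h_def by presburger+
    have "h mod 4 = 1 \<or> h = 3 \<or> (h mod 4 = 3 \<and> 6 \<le> h)"
      using odd_mod_4[OF \<open>odd h\<close>] by presburger
    then consider "h mod 4 = 1" | "h = 3" | "h mod 4 = 3" "6 \<le> h" by blast
    then show ?thesis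
    proof cases
      case 1
      then obtain x y z :: int where "int h = x\<^sup>2 + y\<^sup>2 + z\<^sup>2" using three_squares by blast
      then obtain a b c :: int where "int h = 2 * a\<^sup>2 + 2 * b\<^sup>2 + c\<^sup>2" by (rule three_squares_parity)
      then have "int n = (2 * a)\<^sup>2 + 2 * c\<^sup>2 + 4 * (b\<^sup>2 + b * 0 + 0\<^sup>2)"
        unfolding n by (simp add: power_mult_distrib)
      then show ?thesis by blast
    next
      case 2
      then have "int n = 2\<^sup>2 + 2 * 1\<^sup>2 + 4 * (0\<^sup>2 + 0 * 0 + 0\<^sup>2)" unfolding n by simp
      then show ?thesis by blast
    next
      case 3
      obtain j where j: "h = 4 * j + 3" using 3(1) mult_div_mod_eq[of 4 h] by metis
      with 3(2) obtain i where "j = Suc i" by (cases j) auto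
      then have "(h - 6) mod 4 = 1" using j by simp
      then obtain x y z :: int where "int (h - 6) = x\<^sup>2 + y\<^sup>2 + z\<^sup>2" using three_squares by blast
      then obtain a b c :: int where "int (h - 6) = 2 * a\<^sup>2 + 2 * b\<^sup>2 + c\<^sup>2" by (rule three_squares_parity)
      then have "int h = 6 + 2 * a\<^sup>2 + 2 * b\<^sup>2 + c\<^sup>2" using 3 by simp
      \<comment> \<open>The subtracted 6 becomes 12 after doubling and is absorbed by
        \<open>w = 2\<close>: the norm at \<open>(b - 1, 2)\<close> is
        \<open>b^2 + 3\<close>.\<close>
      then have "int n = (2 * a)\<^sup>2 + 2 * c\<^sup>2 + 4 * ((b - 1)\<^sup>2 + (b - 1) * 2 + 2\<^sup>2)"
        unfolding n by (simp add: power2_eq_square algebra_simps)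
      then show ?thesis by blast
    qed
  qed
qed

section \<open>Necessity of the coefficients 1 and 2\<close>

lemma eisenstein_norm_nonneg: "0 \<le> z\<^sup>2 + z * w + w\<^sup>2" for z w :: int
proof -
  have "2 * (z\<^sup>2 + z * w + w\<^sup>2) = z\<^sup>2 + w\<^sup>2 + (z + w)\<^sup>2" by (simp add: power2_eq_square algebra_simps)
  also have "0 \<le> \<dots>" by simp
  finally show ?thesis by (simp only: zero_le_mult_iff) simp
qed

text \<open>A value below 4 leaves no room for a positive multiple of 4, so the norm term vanishes
  and only the binary form remains.\<close>

lemma small_value_bound:
  fixes a b :: int
  assumes "0 < a" "a \<le> b" "0 < n" "n < 4"
    and n: "n = a * x\<^sup>2 + b * y\<^sup>2 + 4 * (z\<^sup>2 + z * w + w\<^sup>2)"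
  shows "n = a * x\<^sup>2 + b * y\<^sup>2"
proof -
  define N where "N = z\<^sup>2 + z * w + w\<^sup>2"
  have "0 \<le> N" unfolding N_def by (rule eisenstein_norm_nonneg)
  have eq: "n = a * x\<^sup>2 + b * y\<^sup>2 + 4 * N" unfolding N_def by (rule n)
  moreover have "0 \<le> a * x\<^sup>2" "0 \<le> b * y\<^sup>2" using assms by auto
  ultimately have "4 * N < 4" using assms(4) by linarith
  then have "N = 0" using \<open>0 \<le> N\<close> by linarith
  then show ?thesis using eq by simp
qed

lemma mult_square_cases: "0 < a \<Longrightarrow> x = 0 \<or> a \<le> a * x\<^sup>2" for a x :: int
  using mult_left_mono[of 1 "x\<^sup>2" a] by (cases "x = 0") (auto simp: int_one_le_iff_zero_less)

lemma square_mod_4: "u\<^sup>2 mod 4 = 0 \<or> u\<^sup>2 mod 4 = 1" for u :: int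
proof (cases "even u")
  case True
  then show ?thesis by (auto simp: power2_eq_square elim!: evenE)
next
  case False
  then obtain v where "u = 2 * v + 1" by (rule oddE)
  then have "u\<^sup>2 = 1 + 4 * (v\<^sup>2 + v)" by (simp add: power2_eq_square algebra_simps)
  then have "u\<^sup>2 mod 4 = 1 mod 4" by (simp only: mod_mult_self2)
  then show ?thesis by simp
qed

theorem theorem6p3:
  fixes a b :: int
  assumes "0 < a" and "a \<le> b"
  shows "(\<forall>n::int. n \<ge> 0 \<longrightarrow>
            (\<exists>x y z w :: int. n = a * x^2 + b * y^2 + 4 * (z^2 + z * w + w^2)))
         \<longleftrightarrow> (a = 1 \<and> b = 2)"
proof
  assume all: "\<forall>n::int. n \<ge> 0 \<longrightarrow>
    (\<exists>x y z w :: int. n = a * x^2 + b * y^2 + 4 * (z^2 + z * w + w^2))"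
  have rep: "\<exists>x y. n = a * x\<^sup>2 + b * y\<^sup>2" if "0 < n" "n < 4" for n
    using all small_value_bound[OF assms that] that by (metis less_imp_le)
  \<comment> \<open>Some variable is nonzero, and its coefficient is at least \<open>a\<close>
    because \<open>a \<le> b\<close>; hence \<open>a \<le> 1\<close>.\<close>
  obtain x y where "1 = a * x\<^sup>2 + b * y\<^sup>2" using rep[of 1] by auto
  moreover have "0 \<le> a * x\<^sup>2" "0 \<le> b * y\<^sup>2" using assms by auto
  ultimately have "a = 1"
    using mult_square_cases[of a x] mult_square_cases[of b y] assms by fastforce
  \<comment> \<open>As 2 is not a square, \<open>y\<close> is nonzero and \<open>b \<le> 2\<close>;
    the case \<open>b = 1\<close> fails because a sum of two squares is never 3 modulo 4.\<close>
  obtain x y where xy: "2 = a * x\<^sup>2 + b * y\<^sup>2" using rep[of 2] by auto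
  have "y \<noteq> 0"
  proof
    assume "y = 0"
    then have "x\<^sup>2 = 2" using xy \<open>a = 1\<close> by simp
    then show False using square_mod_4[of x] by simp
  qed
  then have "b \<le> b * y\<^sup>2" using mult_square_cases[of b y] assms by auto
  moreover have "0 \<le> a * x\<^sup>2" using assms by simp
  ultimately have "b \<le> 2" using xy by linarith
  moreover have "b \<noteq> 1"
  proof
    assume "b = 1"
    then obtain x y :: int where "3 = x\<^sup>2 + y\<^sup>2" using rep[of 3] \<open>a = 1\<close> by auto
    then have "(x\<^sup>2 mod 4 + y\<^sup>2 mod 4) mod 4 = 3" by (simp add: mod_add_eq)
    then show False using square_mod_4[of x] square_mod_4[of y] by auto
  qed
  ultimately show "a = 1 \<and> b = 2" using \<open>a = 1\<close> assms by auto
next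
  assume "a = 1 \<and> b = 2"
  then show "\<forall>n::int. n \<ge> 0 \<longrightarrow>
    (\<exists>x y z w :: int. n = a * x^2 + b * y^2 + 4 * (z^2 + z * w + w^2))"
    using form_universal by (metis mult_1 nat_0_le)
qed

end
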